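(* Let $n,t$ be positive integers and let $N<n$ be a positive integer. If $$t<\frac{n^2}2-n\left(N-\frac12\right)+\frac{N(N-1)}2+1,$$ then a generic group of $\mathcal N_2(n,t)$ does not admit a surjective homomorphism onto a non-abelian group of polycyclic rank $N$.
   Context: The polycyclic rank (Hirsch length) of a polycyclic group is the number of infinite cyclic factors in a subnormal series with cyclic factors. For a group $G$, $G'$ is the commutator subgroup and $I(G')=\{x\in G\mid x^k\in G'\text{ for some }k\ge 1\}$ the isolator of $G'$. $\operatorname{rk}$ is the (torsion-free) rank of an abelian group. $\mathcal N_2(n,t)$ is the set of all finitely generated torsion-free 2-step nilpotent groups $G$ with $\operatorname{rk}G'=t$ and $\operatorname{rk}G/I(G')=n$. Let $B_n(\mathbb Z)$ be the set of integer skew-symmetric (alternating) bilinear forms on $\mathbb Z^n$ with basis $a_1,\dots,a_n$, viewed as the subset of integer matrices in the space $B_n(\mathbb Q)$ of alternating bilinear forms on $\mathbb Q^n$. For a $t$-tuple $\Phi=(\varphi_1,\dots,\varphi_t)\in B_n(\mathbb Z)^t$, $G(\Phi)$ is the group of formal products $a_1^{k_1}\cdots a_n^{k_n}b_1^{l_1}\cdots b_t^{l_t}$ ($k_i,l_j\in\mathbb Z$) with multiplication $$a_1^{k_1}\cdots a_n^{k_n}b_1^{l_1}\cdots b_t^{l_t}\cdot a_1^{p_1}\cdots a_n^{p_n}b_1^{q_1}\cdots b_t^{q_t}=a_1^{k_1+p_1}\cdots a_n^{k_n+p_n}\prod_{m=1}^t b_m^{\,l_m+q_m+\sum_{i>j}k_ip_j\varphi_m(a_i,a_j)}.$$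 Let $P_{n,t}\subset B_n(\mathbb Z)^t$ be the set of $t$-tuples of linearly independent forms. For $\Phi\in P_{n,t}$ the group $G(\Phi)$ lies in $\mathcal N_2(n,t)$, and every group in $\mathcal N_2(n,t)$ is isomorphic to some such $G(\Phi)$. Generic: a generic group of $\mathcal N_2(n,t)$ has an (isomorphism-invariant) property $\mathcal A$ if the set of $\Phi\in P_{n,t}$ such that $G(\Phi)$ does not have $\mathcal A$ is contained in some proper Zariski-closed subset of the affine space $B_n(\mathbb Q)^t$.
   Formalization: The target group is additionally required to be torsion-free; with torsion allowed the claim fails, since every such G surjects onto a non-abelian finite-index subgroup of Z^N × F, with F a finite non-abelian quotient of G. *)

theory Defs
  imports
    Complex_Main
    "HOL-Algebra.Elementary_Groups"
    "HOL-Library.Poly_Mapping"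
    "Jordan_Normal_Form.Matrix"
begin

section \<open>Alternating forms and the groups G(Phi)\<close>

text \<open>A bilinear form is represented by its Gram matrix in the standard basis, the vector
  \<open>a\<^sub>i\<close> having index \<open>i - 1\<close>. A tuple of forms is a list of matrices.\<close>

definition alt_forms :: "nat \<Rightarrow> 'a::comm_ring_1 mat set" where
  "alt_forms n = {A \<in> carrier_mat n n.
     (\<forall>i<n. A $$ (i, i) = 0) \<and> (\<forall>i<n. \<forall>j<n. A $$ (i, j) = - A $$ (j, i))}"

definition alt_tuples :: "nat \<Rightarrow> nat \<Rightarrow> 'a::comm_ring_1 mat list set" where
  "alt_tuples n t = {\<Phi>. length \<Phi> = t \<and> set \<Phi> \<subseteq> alt_forms n}"

definition rat_tuple :: "int mat list \<Rightarrow> rat mat list" where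
  "rat_tuple \<Phi> = map (map_mat rat_of_int) \<Phi>"

definition lin_indep_tuple :: "nat \<Rightarrow> nat \<Rightarrow> 'a::field mat list \<Rightarrow> bool" where
  "lin_indep_tuple n t \<Phi> \<longleftrightarrow>
     (\<forall>c :: nat \<Rightarrow> 'a. (\<forall>i<n. \<forall>j<n. (\<Sum>m<t. c m * (\<Phi> ! m) $$ (i, j)) = 0)
        \<longrightarrow> (\<forall>m<t. c m = 0))"

definition indep_tuples :: "nat \<Rightarrow> nat \<Rightarrow> int mat list set" where
  "indep_tuples n t = {\<Phi> \<in> alt_tuples n t. lin_indep_tuple n t (rat_tuple \<Phi>)}"

text \<open>The pair \<open>(k, l)\<close> stands for the formal product with exponents \<open>k\<close> of the \<open>a\<^sub>i\<close>
  and \<open>l\<close> of the \<open>b\<^sub>j\<close>.\<close>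

definition form_group :: "nat \<Rightarrow> nat \<Rightarrow> int mat list \<Rightarrow> (int vec \<times> int vec) monoid" where
  "form_group n t \<Phi> =
     \<lparr>carrier = carrier_vec n \<times> carrier_vec t,
      monoid.mult = (\<lambda>(k, l) (p, q).
        (k + p, l + q + vec t (\<lambda>m. \<Sum>i<n. \<Sum>j<i. k $ i * p $ j * (\<Phi> ! m) $$ (i, j)))),
      one = (0\<^sub>v n, 0\<^sub>v t)\<rparr>"

section \<open>The Zariski topology on the space of rational tuples\<close>

text \<open>A polynomial over the rationals in variables indexed by \<open>'v\<close> is a finitely supported
  function from monomials (finitely supported exponent functions) to coefficients.\<close>

definition poly_val :: "(('v \<Rightarrow>\<^sub>0 nat) \<Rightarrow>\<^sub>0 'a::comm_ring_1) \<Rightarrow> ('v \<Rightarrow> 'a) \<Rightarrow> 'a" where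
  "poly_val p x = (\<Sum>\<mu>\<in>Poly_Mapping.keys p. Poly_Mapping.lookup p \<mu> *
     (\<Prod>v\<in>Poly_Mapping.keys \<mu>. x v ^ Poly_Mapping.lookup \<mu> v))"

text \<open>Indices out of range give the coordinate 0, so that variables with such indices do not
  contribute any further closed sets.\<close>

definition tuple_coord :: "nat \<Rightarrow> nat \<Rightarrow> 'a::zero mat list \<Rightarrow> nat \<times> nat \<times> nat \<Rightarrow> 'a" where
  "tuple_coord n t \<Psi> = (\<lambda>(m, i, j). if m < t \<and> i < n \<and> j < n then (\<Psi> ! m) $$ (i, j) else 0)"

definition zariski_closed :: "nat \<Rightarrow> nat \<Rightarrow> rat mat list set \<Rightarrow> bool" where
  "zariski_closed n t Z \<longleftrightarrow>
     (\<exists>S. Z = {\<Psi> \<in> alt_tuples n t. \<forall>p\<in>S. poly_val p (tuple_coord n t \<Psi>) = 0})"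

definition generic_N2 :: "nat \<Rightarrow> nat \<Rightarrow> ((int vec \<times> int vec) monoid \<Rightarrow> bool) \<Rightarrow> bool" where
  "generic_N2 n t \<A> \<longleftrightarrow>
     (\<exists>Z. zariski_closed n t Z \<and> Z \<subset> alt_tuples n t \<and>
       rat_tuple ` {\<Phi> \<in> indep_tuples n t. \<not> \<A> (form_group n t \<Phi>)} \<subseteq> Z)"

section \<open>Polycyclic rank\<close>

abbreviation series_factor :: "'b monoid \<Rightarrow> 'b set list \<Rightarrow> nat \<Rightarrow> 'b set monoid" where
  "series_factor H Ss i \<equiv> (H\<lparr>carrier := Ss ! Suc i\<rparr>) Mod (Ss ! i)"

definition cyclic_series :: "'b monoid \<Rightarrow> 'b set list \<Rightarrow> bool" where
  "cyclic_series H Ss \<longleftrightarrow>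
     Ss \<noteq> [] \<and> hd Ss = {\<one>\<^bsub>H\<^esub>} \<and> last Ss = carrier H \<and> (\<forall>S\<in>set Ss. subgroup S H) \<and>
     (\<forall>i. Suc i < length Ss \<longrightarrow>
        Ss ! i \<lhd> H\<lparr>carrier := Ss ! Suc i\<rparr> \<and> cyclic_group (series_factor H Ss i))"

text \<open>By Schreier's refinement theorem the number of infinite factors does not depend on the
  series, so the relation below holds for exactly one \<open>N\<close> if \<open>H\<close> is polycyclic and for
  none otherwise.\<close>

definition has_polycyclic_rank :: "'b monoid \<Rightarrow> nat \<Rightarrow> bool" where
  "has_polycyclic_rank H N \<longleftrightarrow> group H \<and>
     (\<exists>Ss. cyclic_series H Ss \<and>
        card {i. Suc i < length Ss \<and> infinite (carrier (series_factor H Ss i))} = N)"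

text \<open>Quotients of \<open>form_group n t \<Phi>\<close> are considered within torsion-free groups, like the
  class of groups itself. With torsion allowed, every non-abelian such group has non-abelian
  quotients of every rank from 0 to \<open>n\<close>: the image in \<open>\<int>\<^sup>N \<times> F\<close>, where \<open>F\<close> is a
  finite non-abelian quotient.\<close>

definition torsion_free :: "('b, 'm) monoid_scheme \<Rightarrow> bool" where
  "torsion_free H \<longleftrightarrow>
     (\<forall>x\<in>carrier H. \<forall>k::nat. k \<ge> 1 \<longrightarrow> x [^]\<^bsub>H\<^esub> k = \<one>\<^bsub>H\<^esub> \<longrightarrow> x = \<one>\<^bsub>H\<^esub>)"

end

(* Let f map G(Phi) onto a non-abelian torsion-free group H of rank N.  As the centre of H is infinite, it
  uses up one unit of the rank, so f maps the a-part of some subgroup U of Z^n of rank at least n - N + 1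
  into the centre.  Let K be the kernel of f on the subgroup Z^t generated by the b's.  A functional theta
  that vanishes on K but not on all of Z^t gives a nontrivial combination of the forms in Phi whose radical
  contains U, so whose rank is at most r = N - 1.  Tuples with such a combination are covered by finitely many polynomial maps (choose a form to
  be solved for and a set of r pivots) with
    (t - 1) + (t - 1) (n choose 2) + (r choose 2) + r (n - r)
  parameters, which is less than t (n choose 2) exactly if t <= (n - r choose 2).  Comparing the number of
  monomials of bounded degree in the coordinates and in the parameters yields one nonzero polynomial that
  vanishes on all the images. *)

theory Submission
  imports Defs "HOL-Computational_Algebra.Polynomial" "HOL-Library.Function_Algebras"
    "HOL-Algebra.Multiplicative_Group"
begin

text \<open>Since H is non-abelian, some product of b's has a nontrivial image; this image is
  central and, by torsion-freeness, of infinite order, which is why the centre is infinite. For u in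
  U the image of a^u commutes with everything, so the b-exponents of each commutator of a^u form a
  vector in K. These exponents are the values of the forms at u, so theta kills them. The obstacle
  is that sending x to the image of a^x is a homomorphism only modulo the centre. Ranks are
  therefore counted through sublattices of Z^n, pulled back modulo the centre from the terms of a
  cyclic series, by elimination among integer vectors. The parameter count rests on (n choose 2) =
  (r choose 2) + r (n - r) + (n - r choose 2): parameters minus coordinates is t - 1 - (n - r choose
  2), where the 1 is gained by normalising one coefficient of the combination. Counting monomials
  takes the place of dimension theory for the images, and stacking the linear systems of all charts
  yields a single polynomial.\<close>

section \<open>Underdetermined homogeneous linear systems\<close>

text \<open>Gaussian elimination: an equation \<open>e\<close> in which some unknown
  \<open>m0\<close> has a nonzero coefficient is solved for \<open>m0\<close>, which removes one
  equation and one unknown and so preserves the strict inequality of the cardinalities.\<close>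

lemma homogeneous_system_nontrivial:
  fixes c :: "'m \<Rightarrow> 'e \<Rightarrow> 'a::field"
  assumes "finite E" "finite M" "card E < card M"
  shows "\<exists>a. (\<exists>m\<in>M. a m \<noteq> 0) \<and> (\<forall>e\<in>E. (\<Sum>m\<in>M. a m * c m e) = 0)"
  using assms
proof (induction E arbitrary: M c rule: finite_induct)
  case empty
  then obtain m where "m \<in> M" by (metis card.empty card_gt_0_iff ex_in_conv)
  then show ?case by (intro exI[of _ "\<lambda>_. 1"]) auto
next
  case (insert e E)
  show ?case
  proof (cases "\<forall>m\<in>M. c m e = 0")
    case True
    have "card E < card M" using insert by simp
    from insert.IH[OF insert.prems(1) this, of c] True show ?thesis by auto
  next
    case False
    then obtain m0 where m0: "m0 \<in> M" "c m0 e \<noteq> 0" by auto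
    define c' where "c' m e' = c m e' - c m e / c m0 e * c m0 e'" for m e'
    have "card E < card (M - {m0})" using insert m0 by simp
    then obtain a where a: "\<exists>m\<in>M - {m0}. a m \<noteq> 0"
        "\<forall>e\<in>E. (\<Sum>m\<in>M - {m0}. a m * c' m e) = 0"
      using insert.IH[of "M - {m0}" c'] insert.prems by auto
    \<comment> \<open>The value at \<open>m0\<close> is the one that equation \<open>e\<close>
      dictates.\<close>
    define b where "b = a(m0 := - (\<Sum>m\<in>M - {m0}. a m * c m e) / c m0 e)"
    have *: "(\<Sum>m\<in>M. b m * c m e') = (\<Sum>m\<in>M - {m0}. a m * c' m e')" for e'
    proof -
      have "(\<Sum>m\<in>M. b m * c m e') = b m0 * c m0 e' + (\<Sum>m\<in>M - {m0}. b m * c m e')"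
        using m0 insert.prems by (simp add: sum.remove)
      also have "(\<Sum>m\<in>M - {m0}. b m * c m e') = (\<Sum>m\<in>M - {m0}. a m * c m e')"
        by (rule sum.cong) (auto simp: b_def)
      also have "b m0 * c m0 e' = - (\<Sum>m\<in>M - {m0}. a m * (c m e / c m0 e * c m0 e'))"
        by (simp add: b_def sum_distrib_right sum_divide_distrib mult.assoc)
      finally show ?thesis
        by (simp add: c'_def right_diff_distrib sum_subtractf)
    qed
    have "c' m e = 0" for m using m0 by (simp add: c'_def)
    with * a(2) have "\<forall>e'\<in>insert e E. (\<Sum>m\<in>M. b m * c m e') = 0" by auto
    moreover have "\<exists>m\<in>M. b m \<noteq> 0" using a(1) by (auto simp: b_def)
    ultimately show ?thesis by blast
  qed
qed

section \<open>Polynomial functions and algebraic dependence\<close>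

text \<open>The bound is on each exponent separately, so that a finite \<open>W\<close> gives
  exactly (d + 1)^|W| exponents. Extensionality outside \<open>W\<close> makes this set
  finite.\<close>

abbreviation exps :: "'w set \<Rightarrow> nat \<Rightarrow> ('w \<Rightarrow> nat) set" where
  "exps W d \<equiv> W \<rightarrow>\<^sub>E {..d}"

definition monomial :: "'w set \<Rightarrow> ('w \<Rightarrow> nat) \<Rightarrow> ('w \<Rightarrow> 'a::comm_ring_1) \<Rightarrow> 'a" where
  "monomial W \<mu> x = (\<Prod>w\<in>W. x w ^ \<mu> w)"

text \<open>Being generated by adding single monomials lets closure properties be proved by
  induction without handling coefficients; these are recovered once, in
  \<open>poly_fun_expansion\<close>.\<close>

inductive poly_fun :: "'w set \<Rightarrow> nat \<Rightarrow> (('w \<Rightarrow> 'a::comm_ring_1) \<Rightarrow> 'a) \<Rightarrow> bool" for W d where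
  zero: "poly_fun W d (\<lambda>x. 0)"
| add_monomial: "poly_fun W d f \<Longrightarrow> \<mu> \<in> exps W d \<Longrightarrow> poly_fun W d (\<lambda>x. f x + c * monomial W \<mu> x)"

lemma poly_fun_expansion:
  assumes "poly_fun W d f" "finite W"
  shows "\<exists>a. \<forall>x. f x = (\<Sum>\<mu>\<in>exps W d. a \<mu> * monomial W \<mu> x)"
  using assms(1)
proof induction
  case zero
  show ?case by (intro exI[of _ "\<lambda>_. 0"]) simp
next
  case (add_monomial f \<mu> c)
  then obtain a where a: "\<And>x. f x = (\<Sum>\<mu>\<in>exps W d. a \<mu> * monomial W \<mu> x)" by auto
  have fin: "finite (exps W d)" using assms(2) by (simp add: finite_PiE)
  have "f x + c * monomial W \<mu> x = (\<Sum>\<nu>\<in>exps W d. (a \<nu> + (if \<nu> = \<mu> then c else 0)) * monomial W \<nu> x)" for x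
    using fin add_monomial.hyps
    by (simp add: a distrib_right sum.distrib if_distrib[of "\<lambda>c. c * _"] sum.delta cong: if_cong)
  then show ?case by (intro exI[of _ "\<lambda>\<nu>. a \<nu> + (if \<nu> = \<mu> then c else 0)"]) blast
qed

lemma poly_fun_add:
  assumes "poly_fun W d f" "poly_fun W d g"
  shows "poly_fun W d (\<lambda>x. f x + g x)"
  using assms(2)
proof induction
  case (add_monomial g \<mu> c)
  then show ?case using poly_fun.add_monomial[of W d "\<lambda>x. f x + g x" \<mu> c] by (simp add: add.assoc)
qed (use assms in simp)

lemma poly_fun_sum:
  "(\<And>i. i \<in> I \<Longrightarrow> poly_fun W d (f i)) \<Longrightarrow> poly_fun W d (\<lambda>x. \<Sum>i\<in>I. f i x)"
  by (induction I rule: infinite_finite_induct) (auto intro: poly_fun.zero poly_fun_add)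

lemma poly_fun_monomial: "\<mu> \<in> exps W d \<Longrightarrow> poly_fun W d (monomial W \<mu>)"
  using poly_fun.add_monomial[OF poly_fun.zero, of \<mu> W d 1] by simp

lemma poly_fun_mult_monomial:
  assumes "poly_fun W d f" "\<mu> \<in> exps W e"
  shows "poly_fun W (d + e) (\<lambda>x. f x * (c * monomial W \<mu> x))"
  using assms(1)
proof induction
  case zero
  then show ?case by (simp add: poly_fun.zero)
next
  case (add_monomial f \<nu> b)
  let ?\<kappa> = "\<lambda>w. if w \<in> W then \<mu> w + \<nu> w else undefined"
  have k: "?\<kappa> \<in> exps W (d + e)"
    using assms(2) add_monomial.hyps by (fastforce simp: PiE_iff extensional_def)
  have m: "monomial W ?\<kappa> x = monomial W \<mu> x * (monomial W \<nu> x :: 'b)" for x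
    by (simp add: monomial_def power_add prod.distrib)
  show ?case
    using poly_fun.add_monomial[OF add_monomial.IH k, of "b * c"]
    by (simp add: m algebra_simps)
qed

lemma poly_fun_mult:
  assumes "poly_fun W d f" "poly_fun W e g"
  shows "poly_fun W (d + e) (\<lambda>x. f x * g x)"
  using assms(2)
proof induction
  case zero
  then show ?case by (simp add: poly_fun.zero)
next
  case (add_monomial g \<mu> c)
  then show ?case
    using poly_fun_add[OF add_monomial.IH poly_fun_mult_monomial[OF assms(1) add_monomial.hyps(2), of c]]
    by (simp add: algebra_simps)
qed

lemma poly_fun_const: "poly_fun W d (\<lambda>x. c)"
  using poly_fun.add_monomial[OF poly_fun.zero, of "\<lambda>w\<in>W. 0" W d c] by (simp add: monomial_def)

lemma poly_fun_var:
  assumes "w \<in> W" "finite W" "d > 0"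
  shows "poly_fun W d (\<lambda>x. x w)"
proof -
  have "monomial W (\<lambda>v\<in>W. if v = w then 1 else 0) x = x w" for x :: "'a \<Rightarrow> 'b"
  proof -
    have "monomial W (\<lambda>v\<in>W. if v = w then 1 else 0) x = (\<Prod>v\<in>W. if v = w then x v else 1)"
      unfolding monomial_def by (rule prod.cong) auto
    then show ?thesis using assms by (simp add: prod.delta)
  qed
  moreover have "(\<lambda>v\<in>W. if v = w then 1 else 0) \<in> exps W d" using assms by auto
  ultimately show ?thesis
    using poly_fun_monomial[of "\<lambda>v\<in>W. if v = w then 1 else 0" W d, where 'b = 'b]
    by presburger
qed

lemma poly_fun_mono:
  assumes "poly_fun W d f" "d \<le> e"
  shows "poly_fun W e f"
  using poly_fun_mult[OF assms(1) poly_fun_const[of W "e - d" 1]] assms(2) by simp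

lemma poly_fun_uminus: "poly_fun W d f \<Longrightarrow> poly_fun W d (\<lambda>x. - f x)"
  using poly_fun_mult[OF poly_fun_const[of W 0 "-1"]] by fastforce

lemma poly_fun_power: "poly_fun W d f \<Longrightarrow> poly_fun W (k * d) (\<lambda>x. f x ^ k)"
  by (induction k) (auto intro: poly_fun_const poly_fun_mult)

lemma poly_fun_prod:
  "finite I \<Longrightarrow> (\<And>i. i \<in> I \<Longrightarrow> poly_fun W d (f i)) \<Longrightarrow> poly_fun W (card I * d) (\<lambda>x. \<Prod>i\<in>I. f i x)"
  by (induction I rule: finite_induct) (auto intro: poly_fun_const poly_fun_mult)

text \<open>Substituting the maps \<open>g c\<close> into a general polynomial with unknown
  coefficients \<open>a\<close> and requiring every resulting coefficient to vanish is a linear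
  system in \<open>a\<close>. The systems for all \<open>c\<close> are stacked, so one solution
  serves every chart.\<close>

lemma algebraic_dependence:
  fixes g :: "'c \<Rightarrow> 'v \<Rightarrow> ('w \<Rightarrow> 'a::field) \<Rightarrow> 'a"
  assumes "finite C" "finite V" "\<And>c. c \<in> C \<Longrightarrow> finite (W c)"
    and card: "\<And>c. c \<in> C \<Longrightarrow> card (W c) < card V"
    and g: "\<And>c v. c \<in> C \<Longrightarrow> v \<in> V \<Longrightarrow> poly_fun (W c) d (g c v)"
  shows "\<exists>D a. (\<exists>\<mu>\<in>exps V D. a \<mu> \<noteq> 0) \<and>
           (\<forall>c\<in>C. \<forall>x. (\<Sum>\<mu>\<in>exps V D. a \<mu> * monomial V \<mu> (\<lambda>v. g c v x)) = 0)"
proof (cases "C = {}")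
  case True
  then show ?thesis by (intro exI[of _ 0] exI[of _ "\<lambda>_. 1"]) (auto intro!: bexI[of _ "\<lambda>v\<in>V. 0"])
next
  case False
  \<comment> \<open>The equations number at most \<open>D (D + 1)\<^sup>q\<^sup>-\<^sup>1\<close>, the coefficients to be found \<open>(D + 1)\<^sup>q\<close>.\<close>
  define q where "q = card V"
  define k where "k = q * d + 1"
  \<comment> \<open>Here \<open>q * (D * d) + 1\<close> is at most \<open>k * (D + 1)\<close>. With
    this \<open>D\<close> the bound \<open>card C * (k * (D + 1)) ^ (q - 1)\<close> on the number of
    equations is exactly \<open>D * (D + 1) ^ (q - 1)\<close>.\<close>
  define D where "D = card C * k ^ (q - 1)"
  have q: "q > 0" using False card q_def by fastforce
  define E where "E = (SIGMA c:C. exps (W c) (q * (D * d)))"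
  have finE: "finite E" unfolding E_def using assms by (auto intro!: finite_SigmaI finite_PiE)
  have "card E = (\<Sum>c\<in>C. (q * (D * d) + 1) ^ card (W c))"
    unfolding E_def using assms by (subst card_SigmaI) (auto intro!: finite_PiE sum.cong simp: card_PiE)
  also have "\<dots> \<le> (\<Sum>c\<in>C. (k * (D + 1)) ^ (q - 1))"
  proof (rule sum_mono)
    fix c assume c: "c \<in> C"
    have "(q * (D * d) + 1) ^ card (W c) \<le> (k * (D + 1)) ^ card (W c)"
      by (rule power_mono) (auto simp: k_def algebra_simps)
    also have "\<dots> \<le> (k * (D + 1)) ^ (q - 1)"
      using card[OF c] by (intro power_increasing) (auto simp: q_def k_def)
    finally show "(q * (D * d) + 1) ^ card (W c) \<le> (k * (D + 1)) ^ (q - 1)" .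
  qed
  also have "\<dots> = D * (D + 1) ^ (q - 1)" by (simp only: D_def power_mult_distrib sum_constant mult_ac of_nat_id)
  also have "\<dots> < (D + 1) * (D + 1) ^ (q - 1)" by simp
  also have "\<dots> = card (exps V D)"
    using q assms(2) by (simp add: card_PiE q_def flip: power_Suc)
  finally have less: "card E < card (exps V D)" .
  \<comment> \<open>The coefficients of each substituted monomial, fixed before the linear system is
    set up.\<close>
  define b where "b c \<mu> = (SOME b. \<forall>x. monomial V \<mu> (\<lambda>v. g c v x) =
      (\<Sum>\<kappa>\<in>exps (W c) (q * (D * d)). b \<kappa> * monomial (W c) \<kappa> x))" for c \<mu>
  have b: "monomial V \<mu> (\<lambda>v. g c v x) = (\<Sum>\<kappa>\<in>exps (W c) (q * (D * d)). b c \<mu> \<kappa> * monomial (W c) \<kappa> x)"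
    if "c \<in> C" "\<mu> \<in> exps V D" for c \<mu> x
  proof -
    have "poly_fun (W c) (D * d) (\<lambda>x. g c v x ^ \<mu> v)" if v: "v \<in> V" for v
    proof -
      have "\<mu> v \<le> D" using v \<open>\<mu> \<in> _\<close> by auto
      then show ?thesis
        using poly_fun_mono[OF poly_fun_power[OF g[OF \<open>c \<in> C\<close> v]], of "\<mu> v" "D * d"] by simp
    qed
    then have "\<exists>b. \<forall>x. monomial V \<mu> (\<lambda>v. g c v x) =
        (\<Sum>\<kappa>\<in>exps (W c) (q * (D * d)). b \<kappa> * monomial (W c) \<kappa> x)"
      unfolding monomial_def[of V] q_def using that assms
      by (intro poly_fun_expansion poly_fun_prod) auto
    from someI_ex[OF this] show ?thesis unfolding b_def by blast
  qed
  obtain a where a: "\<exists>\<mu>\<in>exps V D. a \<mu> \<noteq> 0"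
    "\<forall>e\<in>E. (\<Sum>\<mu>\<in>exps V D. a \<mu> * b (fst e) \<mu> (snd e)) = 0"
    using homogeneous_system_nontrivial[OF finE _ less, of "\<lambda>\<mu> e. b (fst e) \<mu> (snd e)"]
      assms(2) by (auto simp: finite_PiE)
  have "(\<Sum>\<mu>\<in>exps V D. a \<mu> * monomial V \<mu> (\<lambda>v. g c v x)) = 0" if c: "c \<in> C" for c x
  proof -
    have "(\<Sum>\<mu>\<in>exps V D. a \<mu> * monomial V \<mu> (\<lambda>v. g c v x)) =
        (\<Sum>\<mu>\<in>exps V D. \<Sum>\<kappa>\<in>exps (W c) (q * (D * d)). a \<mu> * b c \<mu> \<kappa> * monomial (W c) \<kappa> x)"
      by (rule sum.cong) (simp_all add: b[OF c] sum_distrib_left mult.assoc)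
    also have "\<dots> = (\<Sum>\<kappa>\<in>exps (W c) (q * (D * d)). (\<Sum>\<mu>\<in>exps V D. a \<mu> * b c \<mu> \<kappa>) * monomial (W c) \<kappa> x)"
      by (subst sum.swap) (simp add: sum_distrib_right)
    also have "\<dots> = 0"
      using a(2) c by (intro sum.neutral) (force simp: E_def)
    finally show ?thesis .
  qed
  with a(1) show ?thesis by blast
qed

section \<open>Nonvanishing, and passage to \<open>poly_val\<close>\<close>

text \<open>Induction on the variables: by hypothesis some coefficient with respect to the new
  variable \<open>v\<close> is nonzero at a point \<open>x\<close> of the remaining ones. Fixing
  \<open>x\<close> leaves a nonzero univariate polynomial, which has a nonroot since a field of
  characteristic 0 is infinite.\<close>

lemma nonzero_poly_has_nonroot:
  fixes a :: "('v \<Rightarrow> nat) \<Rightarrow> 'a::field_char_0"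
  assumes "finite V" "\<exists>\<mu>\<in>exps V D. a \<mu> \<noteq> 0"
  shows "\<exists>x. (\<Sum>\<mu>\<in>exps V D. a \<mu> * monomial V \<mu> x) \<noteq> 0"
  using assms
proof (induction V arbitrary: a rule: finite_induct)
  case empty
  then show ?case by (simp add: monomial_def)
next
  case (insert v V)
  let ?b = "\<lambda>k \<mu>. a (\<mu>(v := k))"
  obtain \<mu> where \<mu>: "\<mu> \<in> exps (insert v V) D" "a \<mu> \<noteq> 0" using insert.prems by auto
  have "\<mu>(v := undefined) \<in> exps V D" "?b (\<mu> v) (\<mu>(v := undefined)) \<noteq> 0"
    using \<mu> insert.hyps by (auto simp: PiE_iff extensional_def)
  then obtain x where x: "(\<Sum>\<nu>\<in>exps V D. ?b (\<mu> v) \<nu> * monomial V \<nu> x) \<noteq> 0"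
    using insert.IH[of "?b (\<mu> v)"] by blast
  define p where "p = (\<Sum>k\<le>D. Polynomial.monom (\<Sum>\<nu>\<in>exps V D. ?b k \<nu> * monomial V \<nu> x) k)"
  have "\<mu> v \<le> D" using \<mu> by auto
  then have "Polynomial.coeff p (\<mu> v) \<noteq> 0" using x by (simp add: p_def Polynomial.coeff_sum)
  then have "p \<noteq> 0" by auto
  then obtain z where z: "Polynomial.poly p z \<noteq> 0" using poly_all_0_iff_0 by blast
  have "(\<Prod>w\<in>V. (x(v := z)) w ^ (\<nu>(v := k)) w) = monomial V \<nu> x" for \<nu> k
    unfolding monomial_def using insert.hyps by (intro prod.cong) auto
  then have *: "monomial (insert v V) (\<nu>(v := k)) (x(v := z)) = z ^ k * monomial V \<nu> x" for \<nu> k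
    using insert.hyps by (simp add: monomial_def del: fun_upd_apply) simp
  have "(\<Sum>\<mu>\<in>exps (insert v V) D. a \<mu> * monomial (insert v V) \<mu> (x(v := z))) =
     (\<Sum>(k, \<nu>)\<in>{..D} \<times> exps V D. a (\<nu>(v := k)) * monomial (insert v V) (\<nu>(v := k)) (x(v := z)))"
    unfolding PiE_insert_eq
    by (subst sum.reindex[OF inj_combinator]) (use insert.hyps in \<open>auto intro!: sum.cong simp: case_prod_unfold\<close>)
  also have "\<dots> = (\<Sum>(k, \<nu>)\<in>{..D} \<times> exps V D. ?b k \<nu> * (z ^ k * monomial V \<nu> x))"
    using * by (auto intro!: sum.cong)
  also have "\<dots> = (\<Sum>k\<le>D. \<Sum>\<nu>\<in>exps V D. ?b k \<nu> * (z ^ k * monomial V \<nu> x))"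
    by (simp add: sum.cartesian_product)
  also have "\<dots> = Polynomial.poly p z"
    by (simp add: p_def poly_sum poly_monom sum_distrib_left sum_distrib_right mult_ac)
  finally show ?case using z by metis
qed

text \<open>Extensional exponent functions become finitely supported ones when
  \<open>undefined\<close> outside \<open>V\<close> is replaced by 0. This is injective on
  \<open>exps V D\<close>, so the coefficients can be transported.\<close>

lemma poly_val_of_coeffs:
  fixes a :: "('v \<Rightarrow> nat) \<Rightarrow> 'a::comm_ring_1"
  assumes V: "finite V"
  shows "\<exists>p. \<forall>x. poly_val p x = (\<Sum>\<mu>\<in>exps V D. a \<mu> * monomial V \<mu> x)"
proof -
  define e :: "('v \<Rightarrow> nat) \<Rightarrow> ('v \<Rightarrow>\<^sub>0 nat)"
    where "e \<mu> = Abs_poly_mapping (\<lambda>v. if v \<in> V then \<mu> v else 0)" for \<mu>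
  have e: "Poly_Mapping.lookup (e \<mu>) = (\<lambda>v. if v \<in> V then \<mu> v else 0)" for \<mu>
    unfolding e_def using V by (intro Abs_poly_mapping_inverse) simp
  have inj: "inj_on e (exps V D)"
  proof (rule inj_onI)
    fix \<mu> \<nu> assume *: "\<mu> \<in> exps V D" "\<nu> \<in> exps V D" "e \<mu> = e \<nu>"
    have "\<mu> v = \<nu> v" if "v \<in> V" for v
      using arg_cong[OF *(3), of "\<lambda>m. Poly_Mapping.lookup m v"] that by (simp add: e)
    with * show "\<mu> = \<nu>" by (intro PiE_ext)
  qed
  let ?K = "e ` exps V D"
  have finK: "finite ?K" using V by (simp add: finite_PiE)
  define p where "p = Abs_poly_mapping (\<lambda>\<kappa>. if \<kappa> \<in> ?K then a (the_inv_into (exps V D) e \<kappa>) else 0)"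
  have p: "Poly_Mapping.lookup p = (\<lambda>\<kappa>. if \<kappa> \<in> ?K then a (the_inv_into (exps V D) e \<kappa>) else 0)"
    unfolding p_def using finK by (intro Abs_poly_mapping_inverse) simp
  have m: "(\<Prod>v\<in>Poly_Mapping.keys (e \<mu>). x v ^ Poly_Mapping.lookup (e \<mu>) v) = monomial V \<mu> x" for \<mu> and x :: "'v \<Rightarrow> 'a"
    unfolding monomial_def using V
    by (intro prod.mono_neutral_cong_left) (auto split: if_splits simp: e in_keys_iff)
  have "poly_val p x = (\<Sum>\<mu>\<in>exps V D. a \<mu> * monomial V \<mu> x)" for x
  proof -
    have "poly_val p x = (\<Sum>\<kappa>\<in>?K. Poly_Mapping.lookup p \<kappa> * (\<Prod>v\<in>Poly_Mapping.keys \<kappa>. x v ^ Poly_Mapping.lookup \<kappa> v))"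
      unfolding poly_val_def using finK
      by (intro sum.mono_neutral_left) (auto simp: in_keys_iff p split: if_splits)
    also have "\<dots> = (\<Sum>\<mu>\<in>exps V D. Poly_Mapping.lookup p (e \<mu>) * (\<Prod>v\<in>Poly_Mapping.keys (e \<mu>). x v ^ Poly_Mapping.lookup (e \<mu>) v))"
      by (simp add: sum.reindex[OF inj])
    also have "\<dots> = (\<Sum>\<mu>\<in>exps V D. a \<mu> * monomial V \<mu> x)"
      unfolding m by (intro sum.cong) (auto simp: p the_inv_into_f_f[OF inj])
    finally show ?thesis .
  qed
  then show ?thesis by blast
qed

section \<open>Integer linear algebra\<close>

text \<open>Descending from \<open>L (Suc i)\<close> to \<open>L i\<close> costs nothing at a
  torsion step, where each vector is replaced by a nonzero multiple, and costs one vector at a step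
  in \<open>I\<close>, where a vector with nonzero \<open>e\<close> is used to eliminate. More
  vectors than steps in \<open>I\<close> leave a nontrivial combination in \<open>L 0\<close>. No
  additivity is asked of \<open>e\<close>, because in the application it is a mere choice of
  exponents in a cyclic factor.\<close>

lemma chain_dependence:
  fixes A :: "'a set" and L :: "nat \<Rightarrow> (nat \<Rightarrow> int) set"
  assumes comb: "\<And>i x y a b. x \<in> L i \<Longrightarrow> y \<in> L i \<Longrightarrow> (\<lambda>j. a * x j + b * y j) \<in> L i"
    and torsion: "\<And>i x. i < l \<Longrightarrow> i \<notin> I \<Longrightarrow> x \<in> L (Suc i) \<Longrightarrow> \<exists>m::int. m \<noteq> 0 \<and> (\<lambda>j. m * x j) \<in> L i"
    and cyclic: "\<And>i. i < l \<Longrightarrow> i \<in> I \<Longrightarrow> \<exists>e :: (nat \<Rightarrow> int) \<Rightarrow> int. \<forall>x\<in>L (Suc i). \<forall>y\<in>L (Suc i).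
        \<forall>a b. a * e x + b * e y = 0 \<longrightarrow> (\<lambda>j. a * x j + b * y j) \<in> L i"
    and "finite A" "\<And>a. a \<in> A \<Longrightarrow> x a \<in> L l" "card (I \<inter> {..<l}) < card A"
  shows "\<exists>k. (\<exists>a\<in>A. k a \<noteq> 0) \<and> (\<lambda>j. \<Sum>a\<in>A. k a * x a j) \<in> L 0"
  using assms(2-)
proof (induction l arbitrary: A x)
  case 0
  then obtain a where a: "a \<in> A" by fastforce
  have "(\<lambda>j. \<Sum>b\<in>A. (if b = a then 1 else 0) * x b j) = x a"
    using a 0 by (auto simp: if_distrib[of "\<lambda>c. c * _"] cong: if_cong)
  then show ?case using a 0 by (intro exI[of _ "\<lambda>b. if b = a then 1 else 0"]) auto
next
  case (Suc l)
  have IH: "\<exists>k. (\<exists>a\<in>B. k a \<noteq> 0) \<and> (\<lambda>j. \<Sum>a\<in>B. k a * y a j) \<in> L 0"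
    if "finite B" "\<And>a. a \<in> B \<Longrightarrow> y a \<in> L l" "card (I \<inter> {..<l}) < card B" for B :: "'a set" and y
    using Suc.IH[OF Suc.prems(1)[OF less_SucI] Suc.prems(2)[OF less_SucI] that] .
  have sub: "I \<inter> {..<Suc l} = (if l \<in> I then insert l (I \<inter> {..<l}) else I \<inter> {..<l})"
    by (auto simp: lessThan_Suc)
  have c: "card (I \<inter> {..<Suc l}) = (if l \<in> I then Suc (card (I \<inter> {..<l})) else card (I \<inter> {..<l}))"
    unfolding sub by simp
  show ?case
  proof (cases "l \<in> I")
    case False
    have "\<forall>a\<in>A. \<exists>m::int. m \<noteq> 0 \<and> (\<lambda>j. m * x a j) \<in> L l"
      using Suc.prems(1)[OF lessI False Suc.prems(4)] by blast
    from bchoice[OF this] obtain m where m: "\<forall>a\<in>A. m a \<noteq> (0::int) \<and> (\<lambda>j. m a * x a j) \<in> L l" ..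
    have "\<exists>k. (\<exists>a\<in>A. k a \<noteq> 0) \<and> (\<lambda>j. \<Sum>a\<in>A. k a * (m a * x a j)) \<in> L 0"
      using IH[of A "\<lambda>a j. m a * x a j"] Suc.prems m c False by auto
    then obtain k where k: "\<exists>a\<in>A. k a \<noteq> 0" "(\<lambda>j. \<Sum>a\<in>A. k a * (m a * x a j)) \<in> L 0" by auto
    then show ?thesis
      using m by (intro exI[of _ "\<lambda>a. k a * m a"]) (auto simp: mult.assoc)
  next
    case True
    obtain e :: "(nat \<Rightarrow> int) \<Rightarrow> int" where e: "\<And>x y a b. x \<in> L (Suc l) \<Longrightarrow> y \<in> L (Suc l) \<Longrightarrow>
        a * e x + b * e y = 0 \<Longrightarrow> (\<lambda>j. a * x j + b * y j) \<in> L l"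
      using Suc.prems(2)[OF _ True] by blast
    show ?thesis
    proof (cases "\<forall>a\<in>A. e (x a) = 0")
      case True
      have "x a \<in> L l" if "a \<in> A" for a
        using e[OF Suc.prems(4)[OF that] Suc.prems(4)[OF that], of 1 0] True that by simp
      then show ?thesis using IH[of A x] Suc.prems c by (auto split: if_splits)
    next
      case False
      then obtain a0 where a0: "a0 \<in> A" "e (x a0) \<noteq> 0" by auto
      define y where "y a j = e (x a0) * x a j + (- e (x a)) * x a0 j" for a j
      have "y a \<in> L l" if "a \<in> A - {a0}" for a
        unfolding y_def using that a0 Suc.prems(4) by (intro e) auto
      moreover have "card (I \<inter> {..<l}) < card (A - {a0})"
        using Suc.prems(3,5) c \<open>l \<in> I\<close> a0 by simp
      ultimately obtain k where k: "\<exists>a\<in>A - {a0}. k a \<noteq> 0" "(\<lambda>j. \<Sum>a\<in>A - {a0}. k a * y a j) \<in> L 0"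
        using IH[of "A - {a0}" y] Suc.prems(3) by blast
      \<comment> \<open>The combination of the vectors \<open>y a\<close>, rewritten in terms of the
        \<open>x a\<close>; it stays nontrivial because \<open>e (x a0)\<close> is nonzero.\<close>
      define k' where "k' = (\<lambda>a. k a * e (x a0))(a0 := - (\<Sum>a\<in>A - {a0}. k a * e (x a)))"
      have "(\<Sum>a\<in>A. k' a * x a j) = (\<Sum>a\<in>A - {a0}. k a * y a j)" for j
      proof -
        have "(\<Sum>a\<in>A. k' a * x a j) = k' a0 * x a0 j + (\<Sum>a\<in>A - {a0}. k' a * x a j)"
          using a0 Suc.prems by (simp add: sum.remove)
        also have "(\<Sum>a\<in>A - {a0}. k' a * x a j) = (\<Sum>a\<in>A - {a0}. k a * (e (x a0) * x a j))"
          by (rule sum.cong) (auto simp: k'_def)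
        finally show ?thesis
          by (simp add: k'_def y_def right_diff_distrib sum_subtractf sum_distrib_right mult.assoc)
      qed
      then show ?thesis using k a0 by (intro exI[of _ k']) (auto simp: k'_def)
    qed
  qed
qed

text \<open>\<open>indep A\<close> says that the unit vectors indexed by \<open>A\<close> are
  independent modulo \<open>L\<close>. Adding any \<open>i\<close> to a largest such set
  \<open>J0\<close> creates a relation, and that relation must involve \<open>i\<close>. Enlarging
  \<open>J0\<close> to exactly \<open>r\<close> elements keeps these relations and gives every chart
  the same number of pivots.\<close>

lemma pivot_set:
  fixes L :: "(nat \<Rightarrow> int) set"
  assumes dep: "\<And>A. A \<subseteq> {..<n} \<Longrightarrow> r < card A \<Longrightarrow>
      \<exists>k\<in>L. (\<exists>a\<in>A. k a \<noteq> 0) \<and> (\<forall>j. j \<notin> A \<longrightarrow> k j = 0)"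
    and "r \<le> n"
  shows "\<exists>J. J \<subseteq> {..<n} \<and> card J = r \<and>
      (\<forall>i<n. i \<notin> J \<longrightarrow> (\<exists>k\<in>L. k i \<noteq> 0 \<and> (\<forall>j. j \<notin> insert i J \<longrightarrow> k j = 0)))"
proof -
  define indep where "indep A \<longleftrightarrow> A \<subseteq> {..<n} \<and> \<not> (\<exists>k\<in>L. (\<exists>a\<in>A. k a \<noteq> 0) \<and> (\<forall>j. j \<notin> A \<longrightarrow> k j = 0))" for A
  have "indep {}" by (auto simp: indep_def)
  moreover have "\<forall>A. indep A \<longrightarrow> card A \<le> r" using dep unfolding indep_def by (meson not_le)
  then have "\<forall>A. indep A \<longrightarrow> card A < Suc r" by (simp add: less_Suc_eq_le)
  ultimately obtain J0 where J0: "indep J0" "\<And>A. indep A \<Longrightarrow> card A \<le> card J0"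
    using ex_has_greatest_nat[of indep "{}" card "Suc r"] by auto
  have sub: "J0 \<subseteq> {..<n}" using J0(1) by (simp add: indep_def)
  have "card J0 \<le> r" using J0(1) dep unfolding indep_def by (meson not_le)
  then obtain J where J: "J0 \<subseteq> J" "J \<subseteq> {..<n}" "card J = r"
    using exists_subset_between[of J0 r "{..<n}"] sub \<open>r \<le> n\<close> by auto
  have "\<exists>k\<in>L. k i \<noteq> 0 \<and> (\<forall>j. j \<notin> insert i J \<longrightarrow> k j = 0)" if i: "i < n" "i \<notin> J" for i
  proof -
    have "i \<notin> J0" using i J by auto
    moreover have "finite J0" using sub finite_subset by blast
    ultimately have "\<not> indep (insert i J0)" using J0(2)[of "insert i J0"] by auto
    then obtain k where k: "k \<in> L" "\<exists>a\<in>insert i J0. k a \<noteq> 0" "\<And>j. j \<notin> insert i J0 \<Longrightarrow> k j = 0"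
      using i sub unfolding indep_def by auto
    have "k i \<noteq> 0"
    proof
      assume "k i = 0"
      then have "\<exists>a\<in>J0. k a \<noteq> 0" "\<forall>j. j \<notin> J0 \<longrightarrow> k j = 0"
        using k(2,3) by (blast, metis insert_iff)
      then show False using J0(1) k(1) unfolding indep_def by blast
    qed
    then show ?thesis using k J by (intro bexI[of _ k]) auto
  qed
  with J show ?thesis by blast
qed

text \<open>A basis of \<open>V\<close> together with \<open>x\<close> is independent, so the
  function that is 1 at \<open>x\<close> and 0 on the basis extends linearly.\<close>

lemma (in vector_space) subspace_separating_functional:
  assumes V: "subspace V" and x: "x \<notin> V"
  shows "\<exists>g. (\<forall>u v. g (u + v) = g u + g v) \<and> (\<forall>c v. g (c *s v) = c * g v) \<and> (\<forall>v\<in>V. g v = 0) \<and> g x = 1"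
proof -
  interpret vp: vector_space_pair scale "(*) :: 'a \<Rightarrow> 'a \<Rightarrow> 'a"
    by unfold_locales (rule distrib_left distrib_right mult.assoc[symmetric] mult_1_left)+
  obtain B where B: "B \<subseteq> V" "independent B" "V \<subseteq> span B"
    using maximal_independent_subset by blast
  have "span B = V" using span_minimal[OF B(1) V] B(3) by blast
  then have "independent (insert x B)" using x B(2) by (metis independent_insertI)
  then obtain g where g: "Vector_Spaces.linear scale (*) g" "\<forall>v\<in>insert x B. g v = (if v = x then 1 else 0)"
    using vp.linear_independent_extend[of "insert x B" "\<lambda>v. if v = x then 1 else 0"] by blast
  have "\<forall>v\<in>B. g v = 0" using g(2) x B(1) by auto
  then have "\<forall>v\<in>V. g v = 0" using vp.linear_eq_0_on_span[OF g(1), of B] B(3) by blast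
  moreover have "g x = 1" using g(2) by auto
  ultimately show ?thesis using g(1) unfolding Vector_Spaces.linear_iff by blast
qed

lemma separating_functional:
  fixes W :: "(nat \<Rightarrow> int) set"
  assumes comb: "\<And>x y a b. x \<in> W \<Longrightarrow> y \<in> W \<Longrightarrow> (\<lambda>j. a * x j + b * y j) \<in> W"
    and cong: "\<And>x y. x \<in> W \<Longrightarrow> (\<And>j. j < t \<Longrightarrow> x j = y j) \<Longrightarrow> y \<in> W"
    and zero: "(\<lambda>_. 0) \<in> W"
    and l0: "\<And>k. k \<noteq> 0 \<Longrightarrow> (\<lambda>j. k * l0 j) \<notin> W"
  shows "\<exists>\<theta> :: nat \<Rightarrow> rat. (\<forall>l\<in>W. (\<Sum>m<t. \<theta> m * of_int (l m)) = 0) \<and>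
      (\<Sum>m<t. \<theta> m * of_int (l0 m)) \<noteq> 0"
proof -
  let ?s = "\<lambda>(c::rat) (v::nat \<Rightarrow> rat) i. c * v i"
  have md: "Modules.module ?s"
    by unfold_locales (auto simp: fun_eq_iff algebra_simps)
  have vs: "vector_space ?s"
    by unfold_locales (auto simp: fun_eq_iff algebra_simps)
  \<comment> \<open>The rational span of \<open>W\<close>, read in the first \<open>t\<close>
    coordinates. Hypothesis \<open>l0\<close> says precisely that \<open>l0\<close> stays outside
    it.\<close>
  define V where "V = {v :: nat \<Rightarrow> rat. \<exists>k::int. k \<noteq> 0 \<and> (\<exists>w\<in>W. \<forall>i<t. of_int k * v i = of_int (w i))}"
  have VI: "v \<in> V" if "k \<noteq> 0" "w \<in> W" "\<And>i. i < t \<Longrightarrow> of_int k * v i = of_int (w i)" for k w v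
    unfolding V_def using that by blast
  have VE: "\<exists>k w. k \<noteq> 0 \<and> w \<in> W \<and> (\<forall>i<t. of_int k * v i = of_int (w i))" if "v \<in> V" for v
    using that unfolding V_def by blast
  have sV: "Modules.module.subspace ?s V"
  proof (rule Modules.module.subspaceI[OF md])
    show "0 \<in> V" by (rule VI[of 1, OF _ zero]) simp_all
  next
    fix u v assume "u \<in> V" "v \<in> V"
    obtain k x where *: "k \<noteq> 0" "x \<in> W" "\<And>i. i < t \<Longrightarrow> of_int k * u i = of_int (x i)"
      using VE[OF \<open>u \<in> V\<close>] by blast
    obtain l y where **: "l \<noteq> 0" "y \<in> W" "\<And>i. i < t \<Longrightarrow> of_int l * v i = of_int (y i)"
      using VE[OF \<open>v \<in> V\<close>] by blast
    have "of_int (k * l) * (u + v) i = of_int (l * x i + k * y i)" if "i < t" for i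
      unfolding of_int_add of_int_mult *(3)[OF that, symmetric] **(3)[OF that, symmetric] by (simp add: algebra_simps)
    then show "u + v \<in> V" using *(1) **(1) by (intro VI[of "k * l", OF _ comb[OF *(2) **(2), of l k]]) simp_all
  next
    fix c v assume "v \<in> V"
    obtain l y where *: "l \<noteq> 0" "y \<in> W" "\<And>i. i < t \<Longrightarrow> of_int l * v i = of_int (y i)"
      using VE[OF \<open>v \<in> V\<close>] by blast
    obtain p q where pq: "quotient_of c = (p, q)" by (cases "quotient_of c")
    have q: "q > 0" using quotient_of_denom_pos[OF pq] .
    have c: "c = of_int p / of_int q" using quotient_of_div[OF pq] .
    have "of_int (l * q) * ?s c v i = of_int (p * y i + 0 * y i)" if "i < t" for i
      unfolding of_int_add of_int_mult *(3)[OF that, symmetric] using q by (simp add: c)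
    then show "?s c v \<in> V" using *(1) q by (intro VI[of "l * q", OF _ comb[OF *(2,2), of p 0]]) simp_all
  qed
  \<comment> \<open>Cutting off at \<open>t\<close> makes the vector a finite combination of unit
    vectors, so that \<open>g\<close> is determined by the numbers
    \<open>\<theta> m\<close>.\<close>
  define \<rho> where "\<rho> l = (\<lambda>i. if i < t then rat_of_int (l i) else 0)" for l
  have \<rho>0: "\<rho> l0 \<notin> V"
  proof
    assume "\<rho> l0 \<in> V"
    obtain k w where "k \<noteq> 0" "w \<in> W" and *: "\<And>i. i < t \<Longrightarrow> of_int k * \<rho> l0 i = of_int (w i)"
      using VE[OF \<open>\<rho> l0 \<in> V\<close>] by blast
    have "w j = k * l0 j" if "j < t" for j
    proof -
      have "rat_of_int (w j) = of_int (k * l0 j)" using *[OF that] that by (simp add: \<rho>_def)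
      then show ?thesis by (simp only: of_int_eq_iff)
    qed
    then have "(\<lambda>j. k * l0 j) \<in> W" by (rule cong[OF \<open>w \<in> W\<close>])
    with l0[OF \<open>k \<noteq> 0\<close>] show False by contradiction
  qed
  obtain g where g: "(\<forall>u v. g (u + v) = g u + g v) \<and> (\<forall>c v. g (?s c v) = c * g v) \<and>
      (\<forall>v\<in>V. g v = 0) \<and> g (\<rho> l0) = 1"
    using vector_space.subspace_separating_functional[OF vs sV \<rho>0] by (rule exE)
  note gadd = g[THEN conjunct1, rule_format]
    and gscale = g[THEN conjunct2, THEN conjunct1, rule_format]
    and gV = g[THEN conjunct2, THEN conjunct2, THEN conjunct1, rule_format]
    and gl0 = g[THEN conjunct2, THEN conjunct2, THEN conjunct2]
  have g0: "g 0 = 0" using gadd[of 0 0] by simp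
  have gs: "g (\<Sum>m<k. h m) = (\<Sum>m<k. g (h m))" for h :: "nat \<Rightarrow> nat \<Rightarrow> rat" and k :: nat
    by (induction k) (simp_all only: lessThan_0 sum.empty g0 sum.lessThan_Suc gadd)
  define \<theta> where "\<theta> m = g (\<lambda>i. if i = m then 1 else 0)" for m
  have gsum: "g (\<rho> l) = (\<Sum>m<t. \<theta> m * of_int (l m))" for l
  proof -
    let ?\<delta> = "\<lambda>m i. if i = m then 1 else 0 :: rat"
    have app: "(\<Sum>m<k. h m) i = (\<Sum>m<k. h m i)" for h :: "nat \<Rightarrow> nat \<Rightarrow> rat" and k i :: nat
      by (induction k) simp_all
    have "(\<Sum>m<t. of_int (l m) * ?\<delta> m i) = (\<Sum>m<t. if i = m then of_int (l m) else 0)" for i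
      by (rule sum.cong) simp_all
    then have "\<rho> l = (\<Sum>m<t. (\<lambda>i. of_int (l m) * ?\<delta> m i))"
      by (intro ext) (simp add: app \<rho>_def)
    then have "g (\<rho> l) = (\<Sum>m<t. g (\<lambda>i. of_int (l m) * ?\<delta> m i))" by (simp only: gs)
    also have "\<dots> = (\<Sum>m<t. \<theta> m * of_int (l m))"
      unfolding \<theta>_def by (intro sum.cong refl) (simp only: gscale mult.commute)
    finally show ?thesis .
  qed
  have "\<rho> l \<in> V" if "l \<in> W" for l
    by (rule VI[of 1, OF _ that]) (simp_all add: \<rho>_def)
  then have "(\<Sum>m<t. \<theta> m * of_int (l m)) = 0" if "l \<in> W" for l using gV that by (simp flip: gsum)
  moreover have "(\<Sum>m<t. \<theta> m * of_int (l0 m)) \<noteq> 0" using gl0 by (simp flip: gsum)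
  ultimately show ?thesis by blast
qed

section \<open>Steps of a cyclic series\<close>

text \<open>\<open>e x\<close> is an exponent of the coset of \<open>x\<close> with respect to a
  generator of the factor group. It is chosen element by element, so in a finite factor only the
  stated relation can be expected, not additivity.\<close>

lemma (in group) cyclic_step:
  assumes S: "subgroup S G" and T: "subgroup T G" and norm: "S \<lhd> G\<lparr>carrier := T\<rparr>"
    and cyc: "cyclic_group (G\<lparr>carrier := T\<rparr> Mod S)"
  obtains e :: "'a \<Rightarrow> int" where
    "\<And>x y a b. x \<in> T \<Longrightarrow> y \<in> T \<Longrightarrow> a * e x + b * e y = 0 \<Longrightarrow> x [^] a \<otimes> y [^] b \<in> S"
proof -
  let ?K = "G\<lparr>carrier := T\<rparr>" and ?Q = "G\<lparr>carrier := T\<rparr> Mod S"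
  define \<pi> where "\<pi> = (\<lambda>a. S #>\<^bsub>?K\<^esub> a)"
  interpret K: group ?K using T by (rule subgroup_imp_group)
  interpret Q: group ?Q using norm normal.factorgroup_is_group by blast
  interpret \<pi>: group_hom ?K ?Q \<pi>
    unfolding \<pi>_def using normal.r_coset_hom_Mod[OF norm] by unfold_locales
  obtain u where u: "u \<in> carrier ?Q" "carrier ?Q = range (\<lambda>n::int. u [^]\<^bsub>?Q\<^esub> n)"
    using cyc Q.cyclic_group by auto
  have "\<exists>p::int. \<pi> x = u [^]\<^bsub>?Q\<^esub> p" if "x \<in> T" for x
    using \<pi>.hom_closed[of x] u that by auto
  then obtain e where e: "\<And>x. x \<in> T \<Longrightarrow> \<pi> x = u [^]\<^bsub>?Q\<^esub> (e x :: int)" by metis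
  show ?thesis
  proof (rule that[of e])
    fix x y and a b :: int assume *: "x \<in> T" "y \<in> T" "a * e x + b * e y = 0"
    have pow: "z [^] c = z [^]\<^bsub>?K\<^esub> c" if "z \<in> T" for z and c :: int
      using int_pow_consistent[OF T that] .
    have cl: "z [^] c \<in> T" if "z \<in> T" for z and c :: int
      unfolding pow[OF that] using K.int_pow_closed[of z c] that by simp
    have "\<pi> (x [^] a \<otimes> y [^] b) = \<pi> (x [^]\<^bsub>?K\<^esub> a) \<otimes>\<^bsub>?Q\<^esub> \<pi> (y [^]\<^bsub>?K\<^esub> b)"
      using \<pi>.hom_mult[of "x [^] a" "y [^] b"] cl * by (simp flip: pow)
    also have "\<dots> = (\<pi> x [^]\<^bsub>?Q\<^esub> a) \<otimes>\<^bsub>?Q\<^esub> (\<pi> y [^]\<^bsub>?Q\<^esub> b)"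
      using * by (simp add: \<pi>.hom_int_pow)
    also have "\<dots> = u [^]\<^bsub>?Q\<^esub> (e x * a + e y * b)"
      using * u by (simp add: e Q.int_pow_pow Q.int_pow_mult)
    also have "\<dots> = \<one>\<^bsub>?Q\<^esub>" using * by (simp add: mult.commute)
    finally have "S #>\<^bsub>?K\<^esub> (x [^] a \<otimes> y [^] b) = S" by (simp add: \<pi>_def FactGroup_def)
    moreover have "x [^] a \<otimes> y [^] b \<in> T" using subgroup.m_closed[OF T cl[OF *(1)] cl[OF *(2)]] .
    ultimately show "x [^] a \<otimes> y [^] b \<in> S"
      using K.coset_join1[of S "x [^] a \<otimes> y [^] b"] normal_imp_subgroup[OF norm] by simp
  qed
qed

text \<open>Lagrange's theorem in the factor group, with its order as \<open>m\<close>.\<close>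

lemma (in group) finite_step:
  assumes S: "subgroup S G" and T: "subgroup T G" and norm: "S \<lhd> G\<lparr>carrier := T\<rparr>"
    and fin: "finite (carrier (G\<lparr>carrier := T\<rparr> Mod S))"
  obtains m :: nat where "m > 0" "\<And>x. x \<in> T \<Longrightarrow> x [^] m \<in> S"
proof -
  let ?K = "G\<lparr>carrier := T\<rparr>" and ?Q = "G\<lparr>carrier := T\<rparr> Mod S"
  define \<pi> where "\<pi> = (\<lambda>a. S #>\<^bsub>?K\<^esub> a)"
  interpret K: group ?K using T by (rule subgroup_imp_group)
  interpret Q: group ?Q using norm normal.factorgroup_is_group by blast
  interpret \<pi>: group_hom ?K ?Q \<pi>
    unfolding \<pi>_def using normal.r_coset_hom_Mod[OF norm] by unfold_locales
  show ?thesis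
  proof (rule that[of "Coset.order ?Q"])
    show "Coset.order ?Q > 0" using fin Q.order_gt_0_iff_finite by simp
    fix x assume x: "x \<in> T"
    have "\<pi> (x [^]\<^bsub>?K\<^esub> Coset.order ?Q) = \<one>\<^bsub>?Q\<^esub>"
      using x by (simp add: \<pi>.hom_nat_pow Q.pow_order_eq_1)
    then have "S #>\<^bsub>?K\<^esub> (x [^]\<^bsub>?K\<^esub> Coset.order ?Q) = S" by (simp add: \<pi>_def FactGroup_def)
    then have "x [^]\<^bsub>?K\<^esub> Coset.order ?Q \<in> S"
      using K.coset_join1[of S "x [^]\<^bsub>?K\<^esub> Coset.order ?Q"] K.nat_pow_closed[of x] x normal_imp_subgroup[OF norm] by simp
    then show "x [^] Coset.order ?Q \<in> S" by (simp flip: nat_pow_consistent)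
  qed
qed

section \<open>Torsion-free quotients of the groups G(Phi)\<close>

text \<open>The 2-cocycle of \<open>form_group\<close>: the exponent of b_m created by collecting
  a^x a^y. Exponents are functions instead of vectors, which avoids dimension conditions.\<close>

definition twist :: "int mat list \<Rightarrow> (nat \<Rightarrow> int) \<Rightarrow> (nat \<Rightarrow> int) \<Rightarrow> nat \<Rightarrow> nat \<Rightarrow> int" where
  "twist \<Phi> x y n m = (\<Sum>i<n. \<Sum>j<i. x i * y j * (\<Phi> ! m) $$ (i, j))"

lemma twist_zero [simp]: "twist \<Phi> (\<lambda>_. 0) y n m = 0" "twist \<Phi> x (\<lambda>_. 0) n m = 0"
  by (simp_all add: twist_def)

text \<open>The left side is the b_m-exponent of the commutator of a^x and a^y, and the right side
  is the value of the m-th form at (x, y). Of the full double sum, the diagonal vanishes and the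
  upper triangle is minus the lower one with \<open>x\<close> and \<open>y\<close>
  exchanged.\<close>

lemma twist_antisym:
  assumes "\<Phi> \<in> alt_tuples n t" "m < t"
  shows "twist \<Phi> x y n m - twist \<Phi> y x n m = (\<Sum>i<n. \<Sum>j<n. x i * y j * (\<Phi> ! m) $$ (i, j))"
proof -
  let ?A = "\<Phi> ! m"
  have "?A \<in> alt_forms n" using assms by (force simp: alt_tuples_def)
  then have A: "?A $$ (i, i) = 0" "?A $$ (i, j) = - ?A $$ (j, i)" if "i < n" "j < n" for i j
    using that unfolding alt_forms_def by blast+
  let ?lt = "{(i, j). i < n \<and> j < i}" and ?gt = "{(i, j). j < n \<and> i < j}" and ?eq = "{(i, j). i < n \<and> j = i}"
  let ?f = "\<lambda>(i, j). x i * y j * ?A $$ (i, j)"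
  have fin: "finite ?lt" "finite ?gt" "finite ?eq"
    by (rule finite_subset[of _ "{..<n} \<times> {..<n}"]; auto)+
  have S: "twist \<Phi> x y n m = sum (\<lambda>(i, j). x i * y j * ?A $$ (i, j)) ?lt" for x y
  proof -
    have "?lt = (SIGMA i:{..<n}. {..<i})" by auto
    then show ?thesis unfolding twist_def by (simp add: sum.Sigma)
  qed
  have "(\<Sum>i<n. \<Sum>j<n. x i * y j * ?A $$ (i, j)) = sum ?f (?lt \<union> ?gt \<union> ?eq)"
    unfolding sum.cartesian_product by (rule sum.cong) auto
  also have "\<dots> = sum ?f ?lt + sum ?f ?gt + sum ?f ?eq"
    using fin by (subst sum.union_disjoint, auto)+
  also have "sum ?f ?eq = 0" using A(1) by (intro sum.neutral) auto
  also have "sum ?f ?gt = (\<Sum>(i, j)\<in>?lt. x j * y i * ?A $$ (j, i))"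
    by (rule sum.reindex_bij_witness[of _ "\<lambda>(i, j). (j, i)" "\<lambda>(i, j). (j, i)"]) auto
  also have "\<dots> = (\<Sum>(i, j)\<in>?lt. - (y i * x j * ?A $$ (i, j)))"
  proof (rule sum.cong[OF refl], clarify)
    fix i j assume "i < n" "j < i"
    then show "x j * y i * ?A $$ (j, i) = - (y i * x j * ?A $$ (i, j))"
      using A(2)[of j i] by simp
  qed
  also have "\<dots> = - twist \<Phi> y x n m" unfolding S by (simp add: sum_negf case_prod_unfold)
  finally show ?thesis using S[of x y] by simp
qed

locale form_group_quotient = group H for H :: "'a monoid" (structure) +
  fixes n t :: nat and \<Phi> :: "int mat list" and f
  assumes alt: "\<Phi> \<in> alt_tuples n t"
    and epi: "f \<in> epi (form_group n t \<Phi>) H"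
begin

section \<open>Images of normal forms and congruence modulo the centre\<close>

definition F :: "(nat \<Rightarrow> int) \<Rightarrow> (nat \<Rightarrow> int) \<Rightarrow> 'a" where
  "F x l = f (vec n x, vec t l)"

definition Z :: "'a set" where
  "Z = {z \<in> carrier H. \<forall>h\<in>carrier H. z \<otimes> h = h \<otimes> z}"

text \<open>Equality in H/Z, expressed by elements of \<open>H\<close>.\<close>

definition eqZ :: "'a \<Rightarrow> 'a \<Rightarrow> bool" (infix "\<simeq>" 50) where
  "u \<simeq> v \<longleftrightarrow> v \<in> carrier H \<and> (\<exists>z\<in>Z. u = v \<otimes> z)"

lemma F_closed [simp]: "F x l \<in> carrier H"
  using epi by (auto simp: F_def epi_def form_group_def)

lemma F_surj: "h \<in> carrier H \<Longrightarrow> \<exists>x l. h = F x l"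
proof -
  assume "h \<in> carrier H"
  then have "h \<in> f ` (carrier_vec n \<times> carrier_vec t)"
    using epi by (simp add: epi_def form_group_def)
  then obtain k l where *: "k \<in> carrier_vec n" "l \<in> carrier_vec t" "h = f (k, l)" by blast
  have "vec n (($) k) = k" "vec t (($) l) = l" using *(1,2) by auto
  then have "h = F (($) k) (($) l)" using *(3) by (simp add: F_def)
  then show ?thesis by blast
qed

lemma F_mult: "F x l \<otimes> F y l' = F (\<lambda>i. x i + y i) (\<lambda>m. l m + l' m + twist \<Phi> x y n m)"
proof -
  have "f \<in> hom (form_group n t \<Phi>) H" using epi by (simp add: epi_def)
  then have "F x l \<otimes> F y l' = f ((vec n x, vec t l) \<otimes>\<^bsub>form_group n t \<Phi>\<^esub> (vec n y, vec t l'))"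
    unfolding F_def by (subst hom_mult) (simp_all add: form_group_def)
  also have "(vec n x, vec t l) \<otimes>\<^bsub>form_group n t \<Phi>\<^esub> (vec n y, vec t l') =
      (vec n (\<lambda>i. x i + y i), vec t (\<lambda>m. l m + l' m + twist \<Phi> x y n m))"
    unfolding form_group_def twist_def by (auto intro!: eq_vecI sum.cong)
  finally show ?thesis by (simp add: F_def)
qed

lemma F_cong: "(\<And>i. i < n \<Longrightarrow> x i = x' i) \<Longrightarrow> (\<And>m. m < t \<Longrightarrow> l m = l' m) \<Longrightarrow> F x l = F x' l'"
proof -
  assume "\<And>i. i < n \<Longrightarrow> x i = x' i" "\<And>m. m < t \<Longrightarrow> l m = l' m"
  then have "vec n x = vec n x'" "vec t l = vec t l'" by (auto intro!: eq_vecI)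
  then show ?thesis by (simp add: F_def)
qed

lemma F_zero: "F (\<lambda>_. 0) (\<lambda>_. 0) = \<one>"
  using F_mult[of "\<lambda>_. 0" "\<lambda>_. 0" "\<lambda>_. 0" "\<lambda>_. 0"] by (simp add: r_cancel_one)

lemma F_central_mult: "F x l \<otimes> F (\<lambda>_. 0) l' = F x (\<lambda>m. l m + l' m)"
  by (simp add: F_mult)

lemma F_central: "F (\<lambda>_. 0) l \<in> Z"
proof -
  have "F (\<lambda>_. 0) l \<otimes> h = h \<otimes> F (\<lambda>_. 0) l" if "h \<in> carrier H" for h
    using F_surj[OF that] by (auto simp: F_mult add.commute)
  then show ?thesis unfolding Z_def using F_closed by blast
qed

lemma Z_carrier: "z \<in> Z \<Longrightarrow> z \<in> carrier H" by (simp add: Z_def)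

lemma Z_commute: "z \<in> Z \<Longrightarrow> h \<in> carrier H \<Longrightarrow> z \<otimes> h = h \<otimes> z" by (simp add: Z_def)

lemma Z_I: "z \<in> carrier H \<Longrightarrow> (\<And>h. h \<in> carrier H \<Longrightarrow> z \<otimes> h = h \<otimes> z) \<Longrightarrow> z \<in> Z"
  unfolding Z_def by blast

lemma Z_subgroup: "subgroup Z H"
proof
  fix x y assume *: "x \<in> Z" "y \<in> Z"
  have "x \<otimes> y \<otimes> h = h \<otimes> (x \<otimes> y)" if "h \<in> carrier H" for h
  proof -
    have c: "x \<in> carrier H" "y \<in> carrier H" using * by (auto intro: Z_carrier)
    have "x \<otimes> y \<otimes> h = x \<otimes> (h \<otimes> y)" using Z_commute[OF *(2) that] c that by (simp add: m_assoc)
    also have "\<dots> = x \<otimes> h \<otimes> y" using c that by (simp add: m_assoc)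
    also have "\<dots> = h \<otimes> (x \<otimes> y)" using Z_commute[OF *(1) that] c that by (simp add: m_assoc)
    finally show ?thesis .
  qed
  then show "x \<otimes> y \<in> Z" using Z_carrier[OF *(1)] Z_carrier[OF *(2)] by (intro Z_I m_closed)
next
  fix x assume *: "x \<in> Z"
  have "inv x \<otimes> h = h \<otimes> inv x" if "h \<in> carrier H" for h
  proof -
    have x: "x \<in> carrier H" using * by (rule Z_carrier)
    have "inv x \<otimes> h = inv x \<otimes> (h \<otimes> x) \<otimes> inv x" using x that by (simp add: m_assoc)
    also have "\<dots> = inv x \<otimes> (x \<otimes> h) \<otimes> inv x" using Z_commute[OF * that] by simp
    also have "\<dots> = h \<otimes> inv x" using x that by (simp flip: m_assoc)
    finally show ?thesis .
  qed
  then show "inv x \<in> Z" using Z_carrier[OF *] by (intro Z_I inv_closed)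
qed (auto simp: Z_def)

lemma eqZ_refl: "u \<in> carrier H \<Longrightarrow> u \<simeq> u"
  unfolding eqZ_def using subgroup.one_closed[OF Z_subgroup] by force

lemma eqZ_I: "v \<in> carrier H \<Longrightarrow> z \<in> Z \<Longrightarrow> v \<otimes> z \<simeq> v"
  unfolding eqZ_def by blast

lemma eqZ_E:
  assumes "u \<simeq> v"
  obtains z where "z \<in> Z" "z \<in> carrier H" "v \<in> carrier H" "u = v \<otimes> z"
  using assms Z_carrier unfolding eqZ_def by blast

lemma eqZ_sym: "u \<simeq> v \<Longrightarrow> v \<simeq> u"
proof (elim eqZ_E)
  fix z assume z: "z \<in> Z" "z \<in> carrier H" "v \<in> carrier H" "u = v \<otimes> z"
  then have "v = u \<otimes> inv z" by (simp add: m_assoc)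
  moreover have "u \<in> carrier H" using z by simp
  ultimately show "v \<simeq> u" using eqZ_I subgroup.m_inv_closed[OF Z_subgroup z(1)] by metis
qed

lemma eqZ_trans [trans]: "u \<simeq> v \<Longrightarrow> v \<simeq> w \<Longrightarrow> u \<simeq> w"
proof (elim eqZ_E)
  fix z y assume *: "z \<in> Z" "z \<in> carrier H" "u = v \<otimes> z" "y \<in> Z" "y \<in> carrier H" "w \<in> carrier H" "v = w \<otimes> y"
  then have "u = w \<otimes> (y \<otimes> z)" by (simp add: m_assoc)
  then show "u \<simeq> w" using eqZ_I * subgroup.m_closed[OF Z_subgroup] by metis
qed

lemma eqZ_mult:
  assumes "u \<simeq> v" "u' \<simeq> v'"
  shows "u \<otimes> u' \<simeq> v \<otimes> v'"
proof -
  obtain z where z: "z \<in> Z" "z \<in> carrier H" "v \<in> carrier H" "u = v \<otimes> z" using assms(1) by (rule eqZ_E)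
  obtain y where y: "y \<in> Z" "y \<in> carrier H" "v' \<in> carrier H" "u' = v' \<otimes> y" using assms(2) by (rule eqZ_E)
  have "u \<otimes> u' = v \<otimes> (z \<otimes> v') \<otimes> y" using z y by (simp add: m_assoc)
  also have "\<dots> = v \<otimes> v' \<otimes> (z \<otimes> y)" unfolding Z_commute[OF z(1) y(3)] using z y by (simp add: m_assoc)
  finally show ?thesis using eqZ_I subgroup.m_closed[OF Z_subgroup z(1) y(1)] z y by simp
qed

lemma eqZ_int_pow:
  assumes "u \<simeq> v"
  shows "u [^] (a::int) \<simeq> v [^] a"
proof -
  obtain z where z: "z \<in> Z" "z \<in> carrier H" "v \<in> carrier H" "u = v \<otimes> z" using assms by (rule eqZ_E)
  have "u [^] a = v [^] a \<otimes> z [^] a"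
    unfolding z(4) using z Z_commute[OF z(1,3)] by (intro int_pow_mult_distrib) simp_all
  then show ?thesis using eqZ_I subgroup_int_pow_closed[OF Z_subgroup z(1)] z(3) by simp
qed

section \<open>The map from Z^n to H modulo its centre\<close>

abbreviation g :: "(nat \<Rightarrow> int) \<Rightarrow> 'a" where "g x \<equiv> F x (\<lambda>_. 0)"

text \<open>The cocycle correction is a product of b's, so its image is central and disappears
  modulo \<open>Z\<close>.\<close>

lemma g_add: "g (\<lambda>i. x i + y i) \<simeq> g x \<otimes> g y"
proof -
  have "g x \<otimes> g y = g (\<lambda>i. x i + y i) \<otimes> F (\<lambda>_. 0) (twist \<Phi> x y n)"
    unfolding F_central_mult by (simp add: F_mult)
  then have "g x \<otimes> g y \<simeq> g (\<lambda>i. x i + y i)" using eqZ_I F_central F_closed by simp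
  then show ?thesis by (rule eqZ_sym)
qed

lemma g_scale: "g (\<lambda>i. a * x i) \<simeq> g x [^] a"
proof -
  have nat: "g (\<lambda>i. int k * x i) \<simeq> g x [^] int k" for k
  proof (induction k)
    case 0
    then show ?case by (simp add: F_zero eqZ_refl)
  next
    case (Suc k)
    have "g (\<lambda>i. int k * x i + x i) \<simeq> g (\<lambda>i. int k * x i) \<otimes> g x" by (rule g_add)
    also have "\<dots> \<simeq> g x [^] int k \<otimes> g x" by (intro eqZ_mult Suc.IH eqZ_refl F_closed)
    also have "g x [^] int k \<otimes> g x = g x [^] int (Suc k)" by (simp only: int_pow_int nat_pow_Suc)
    also have "(\<lambda>i. int k * x i + x i) = (\<lambda>i. int (Suc k) * x i)" by (simp add: algebra_simps)
    finally show ?case .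
  qed
  show ?thesis
  proof (cases "a \<ge> 0")
    case True
    then show ?thesis using nat[of "nat a"] by simp
  next
    case False
    define k where "k = nat (- a)"
    have a: "a = - int k" using False by (simp add: k_def)
    let ?u = "g (\<lambda>i. a * x i)" and ?v = "g (\<lambda>i. int k * x i)"
    have "g (\<lambda>i. a * x i + int k * x i) \<simeq> ?u \<otimes> ?v" by (rule g_add)
    then have 1: "?u \<otimes> ?v \<simeq> \<one>" using eqZ_sym by (simp add: a F_zero)
    have 2: "inv ?v \<simeq> g x [^] a"
      using eqZ_int_pow[OF nat[of k], of "-1"] by (simp add: int_pow_neg a)
    show ?thesis using eqZ_mult[OF 1 2] by (simp add: m_assoc)
  qed
qed

lemma g_comb:
  assumes "g x \<simeq> s" "g y \<simeq> s'"
  shows "g (\<lambda>i. a * x i + b * y i) \<simeq> s [^] a \<otimes> s' [^] b"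
proof -
  have "g (\<lambda>i. a * x i + b * y i) \<simeq> g (\<lambda>i. a * x i) \<otimes> g (\<lambda>i. b * y i)" by (rule g_add)
  also have "\<dots> \<simeq> g x [^] a \<otimes> g y [^] b" by (intro eqZ_mult g_scale)
  also have "\<dots> \<simeq> s [^] a \<otimes> s' [^] b" using assms by (intro eqZ_mult eqZ_int_pow)
  finally show ?thesis .
qed

text \<open>The preimage of SZ/Z under the homomorphism from Z^n to H/Z. For the trivial subgroup it
  is the lattice U of the overview.\<close>

definition preimage_mod_center :: "'a set \<Rightarrow> (nat \<Rightarrow> int) set" where
  "preimage_mod_center S = {x. \<exists>s\<in>S. g x \<simeq> s}"

lemma preimage_mod_center_comb:
  assumes S: "subgroup S H" and "x \<in> preimage_mod_center S" "y \<in> preimage_mod_center S"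
  shows "(\<lambda>i. a * x i + b * y i) \<in> preimage_mod_center S"
proof -
  obtain s s' where s: "s \<in> S" "g x \<simeq> s" "s' \<in> S" "g y \<simeq> s'"
    using assms unfolding preimage_mod_center_def by blast
  have "s [^] a \<otimes> s' [^] b \<in> S"
    using s by (intro subgroup.m_closed[OF S] subgroup_int_pow_closed[OF S])
  moreover have "g (\<lambda>i. a * x i + b * y i) \<simeq> s [^] a \<otimes> s' [^] b"
    using s by (intro g_comb)
  ultimately show ?thesis unfolding preimage_mod_center_def by blast
qed

lemma central_if_in_preimage_one:
  assumes "x \<in> preimage_mod_center {\<one>}" shows "g x \<in> Z"
  using assms Z_carrier unfolding preimage_mod_center_def eqZ_def by force

section \<open>Polycyclic rank bounds the corank of the lattice U\<close>

text \<open>The preimages of the terms of a cyclic series form a chain from U up to all of Z^n.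
  \<open>chain_dependence\<close> is applied to the unit vectors indexed by \<open>A\<close>, with
  all infinite factors except one counted as costly steps.\<close>

lemma polycyclic_rank_dependence:
  assumes rank: "has_polycyclic_rank H N"
    and c: "c \<in> Z" "\<And>k::nat. k \<ge> 1 \<Longrightarrow> c [^] k \<noteq> \<one>"
    and A: "finite A" "N - 1 < card A"
  shows "\<exists>k\<in>preimage_mod_center {\<one>}. (\<exists>a\<in>A. k a \<noteq> 0) \<and> (\<forall>j. j \<notin> A \<longrightarrow> k j = 0)"
proof -
  obtain Ss where Ss: "cyclic_series H Ss"
    "card {i. Suc i < length Ss \<and> infinite (carrier (series_factor H Ss i))} = N"
    using rank unfolding has_polycyclic_rank_def by blast
  define l where "l = length Ss - 1"
  have len: "length Ss = Suc l" using Ss(1) by (cases Ss) (auto simp: cyclic_series_def l_def)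
  have S0: "Ss ! 0 = {\<one>}" and Sl: "Ss ! l = carrier H"
    using Ss(1) len unfolding cyclic_series_def l_def by (auto simp: hd_conv_nth last_conv_nth)
  have sub: "subgroup (Ss ! i) H" if "i \<le> l" for i
    using Ss(1) len that unfolding cyclic_series_def by (auto simp: less_Suc_eq_le)
  have norm: "Ss ! i \<lhd> H\<lparr>carrier := Ss ! Suc i\<rparr>" and cyc: "cyclic_group (series_factor H Ss i)" if "i < l" for i
    using Ss(1) len that unfolding cyclic_series_def by auto
  define inf where "inf i \<longleftrightarrow> infinite (carrier (series_factor H Ss i))" for i
  have cN: "card {i. i < l \<and> inf i} = N" using Ss(2) len unfolding inf_def by simp
  have cc: "c \<in> carrier H" using c(1) by (rule Z_carrier)
  have fin_pow: "\<exists>m::nat. m > 0 \<and> (\<forall>x\<in>Ss ! Suc i. x [^] m \<in> Ss ! i)" if "i < l" "\<not> inf i" for i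
  proof -
    have fin: "finite (carrier (series_factor H Ss i))" using that unfolding inf_def by blast
    show ?thesis
      by (rule finite_step[OF sub sub norm fin]) (use that in auto)
  qed
  \<comment> \<open>At the step \<open>i0\<close> where powers of \<open>c\<close> enter the series, the factor is infinite but becomes torsion
    modulo the centre: this is the unit of the rank lost to the centre.\<close>
  define P where "P i \<longleftrightarrow> (\<exists>k::nat. k \<ge> 1 \<and> c [^] k \<in> Ss ! i)" for i
  have "\<not> P 0" using c(2) S0 unfolding P_def by auto
  moreover have "P l" using cc Sl unfolding P_def by (auto intro: exI[of _ 1])
  ultimately obtain i0 where i0: "i0 < l" "\<not> P i0" "P (Suc i0)"
  proof -
    assume *: "\<not> P 0" "P l" and that: "\<And>i. i < l \<Longrightarrow> \<not> P i \<Longrightarrow> P (Suc i) \<Longrightarrow> thesis"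
    have "\<exists>i<l. \<not> P i \<and> P (Suc i)" using * by (induction l) (auto simp: less_Suc_eq)
    then show thesis using that by blast
  qed
  obtain k0 :: nat where k0: "k0 \<ge> 1" "c [^] k0 \<in> Ss ! Suc i0" using i0(3) unfolding P_def by blast
  \<comment> \<open>A finite factor at \<open>i0\<close> would push a further power of
    \<open>c\<close> into the term \<open>Ss ! i0\<close>.\<close>
  have inf0: "inf i0"
  proof (rule ccontr)
    assume "\<not> inf i0"
    then obtain m :: nat where m: "m > 0" "\<forall>x\<in>Ss ! Suc i0. x [^] m \<in> Ss ! i0"
      using fin_pow i0(1) by blast
    then have "c [^] (k0 * m) \<in> Ss ! i0" using k0 cc by (simp flip: nat_pow_pow)
    then show False using i0(2) m(1) k0(1) unfolding P_def
      by (metis One_nat_def Suc_leI nat_0_less_mult_iff not_less_eq_eq zero_less_iff_neq_zero le_0_eq)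
  qed
  define I where "I = {i. i < l \<and> inf i} - {i0}"
  \<comment> \<open>The truncation by \<open>min\<close> makes every \<open>L i\<close> come from a
    subgroup, since closure under combinations is required for all \<open>i\<close>.\<close>
  define L where "L i = preimage_mod_center (Ss ! min i l)" for i
  have cI: "card (I \<inter> {..<l}) = N - 1"
  proof -
    have "I \<inter> {..<l} = I" unfolding I_def by auto
    then show ?thesis unfolding I_def using cN i0(1) inf0 by simp
  qed
  let ?\<delta> = "\<lambda>a j :: nat. if j = a then 1 else 0 :: int"
  have "\<exists>k. (\<exists>a\<in>A. k a \<noteq> 0) \<and> (\<lambda>j. \<Sum>a\<in>A. k a * ?\<delta> a j) \<in> L 0"
  proof (rule chain_dependence[where I = I and l = l])
    show "(\<lambda>j. a * x j + b * y j) \<in> L i" if "x \<in> L i" "y \<in> L i" for i x y a b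
      using that unfolding L_def by (intro preimage_mod_center_comb sub) simp
    show "finite A" "card (I \<inter> {..<l}) < card A" using A cI by simp_all
    show "?\<delta> a \<in> L l" for a
      unfolding L_def preimage_mod_center_def by (simp add: Sl, rule bexI, rule eqZ_refl) (rule F_closed)+
    show "\<exists>m::int. m \<noteq> 0 \<and> (\<lambda>j. m * x j) \<in> L i" if i: "i < l" "i \<notin> I" and x: "x \<in> L (Suc i)" for i x
    proof -
      obtain s where s: "s \<in> Ss ! Suc i" "g x \<simeq> s"
        using x i(1) unfolding L_def preimage_mod_center_def by (auto simp: min_absorb1)
      have sc: "s \<in> carrier H" using subgroup.mem_carrier[OF sub s(1)] i(1) by simp
      have scale: "g (\<lambda>j. m * x j) \<simeq> s [^] m" for m
        using eqZ_trans[OF g_scale eqZ_int_pow[OF s(2)]] .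
      show ?thesis
      proof (cases "i = i0")
        case False
        then obtain m :: nat where m: "m > 0" "\<forall>x\<in>Ss ! Suc i. x [^] m \<in> Ss ! i"
          using fin_pow i unfolding I_def by blast
        have "s [^] int m \<in> Ss ! i" using m s by (simp add: int_pow_int)
        then have "(\<lambda>j. int m * x j) \<in> L i"
          unfolding L_def preimage_mod_center_def using scale[of "int m"] i(1) by auto
        then show ?thesis using m(1) by (intro exI[of _ "int m"]) simp
      next
        case True
        obtain e :: "'a \<Rightarrow> int" where e: "\<And>x y a b. x \<in> Ss ! Suc i \<Longrightarrow> y \<in> Ss ! Suc i \<Longrightarrow>
            a * e x + b * e y = 0 \<Longrightarrow> x [^] a \<otimes> y [^] b \<in> Ss ! i"
          using cyclic_step[OF sub sub norm cyc] i(1) by (metis Suc_leI less_imp_le)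
        \<comment> \<open>Cancelling exponents against the central element \<open>d\<close> puts
          \<open>s [^] e d \<otimes> d [^] (- e s)\<close> into \<open>Ss ! i\<close>. Modulo the
          centre this is \<open>s [^] e d\<close>, so the multiple of \<open>x\<close> by
          \<open>e d\<close> descends and the step is torsion.\<close>
        define d where "d = c [^] k0"
        have d: "d \<in> Ss ! Suc i" "d \<in> Z" "d \<in> carrier H" "d \<notin> Ss ! i"
          using k0 i0 True cc subgroup_int_pow_closed[OF Z_subgroup c(1), of "int k0"]
          unfolding d_def P_def by (auto simp: int_pow_int)
        have "e d \<noteq> 0" using e[OF d(1) d(1), of 1 0] d(3,4) by auto
        moreover have "s [^] e d \<otimes> d [^] (- e s) \<in> Ss ! i"
          by (rule e[OF s(1) d(1)]) (simp add: mult.commute)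
        moreover have "g (\<lambda>j. e d * x j) \<simeq> s [^] e d \<otimes> d [^] (- e s)"
        proof (rule eqZ_trans[OF scale])
          have "s [^] e d \<otimes> d [^] (- e s) \<simeq> s [^] e d"
            using sc by (intro eqZ_I subgroup_int_pow_closed[OF Z_subgroup d(2)] int_pow_closed)
          then show "s [^] e d \<simeq> s [^] e d \<otimes> d [^] (- e s)" by (rule eqZ_sym)
        qed
        ultimately show ?thesis unfolding L_def preimage_mod_center_def using i(1) by auto
      qed
    qed
    show "\<exists>e. \<forall>x\<in>L (Suc i). \<forall>y\<in>L (Suc i). \<forall>a b. a * e x + b * e y = 0 \<longrightarrow> (\<lambda>j. a * x j + b * y j) \<in> L i"
      if i: "i < l" "i \<in> I" for i
    proof -
      obtain e :: "'a \<Rightarrow> int" where e: "\<And>x y a b. x \<in> Ss ! Suc i \<Longrightarrow> y \<in> Ss ! Suc i \<Longrightarrow>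
          a * e x + b * e y = 0 \<Longrightarrow> x [^] a \<otimes> y [^] b \<in> Ss ! i"
        using cyclic_step[OF sub sub norm cyc] i(1) by (metis Suc_leI less_imp_le)
      have "\<forall>x\<in>L (Suc i). \<exists>s. s \<in> Ss ! Suc i \<and> g x \<simeq> s"
        using i(1) unfolding L_def preimage_mod_center_def by (auto simp: min_absorb1)
      \<comment> \<open>A representative \<open>r x\<close> in the series term is fixed for each
        \<open>x\<close>, so that \<open>e \<circ> r\<close> measures vectors instead of group
        elements.\<close>
      from bchoice[OF this] obtain r where r: "\<forall>x\<in>L (Suc i). r x \<in> Ss ! Suc i \<and> g x \<simeq> r x" ..
      have "(\<lambda>j. a * x j + b * y j) \<in> L i"
        if "x \<in> L (Suc i)" "y \<in> L (Suc i)" "a * e (r x) + b * e (r y) = 0" for x y a b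
      proof -
        have "r x [^] a \<otimes> r y [^] b \<in> Ss ! i" using e r that by blast
        moreover have "g (\<lambda>j. a * x j + b * y j) \<simeq> r x [^] a \<otimes> r y [^] b"
          using r that by (intro g_comb) auto
        ultimately show ?thesis unfolding L_def preimage_mod_center_def using i(1) by auto
      qed
      then show ?thesis by (intro exI[of _ "e \<circ> r"]) auto
    qed
  qed
  then obtain k where k: "\<exists>a\<in>A. k a \<noteq> 0" "(\<lambda>j. \<Sum>a\<in>A. k a * ?\<delta> a j) \<in> L 0" by blast
  have eq: "(\<Sum>a\<in>A. k a * ?\<delta> a j) = (if j \<in> A then k j else 0)" for j
  proof -
    have "(\<Sum>a\<in>A. k a * ?\<delta> a j) = (\<Sum>a\<in>A. if j = a then k a else 0)" by (rule sum.cong) auto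
    then show ?thesis using A(1) by simp
  qed
  show ?thesis
    using k unfolding eq L_def by (intro bexI[of _ "\<lambda>j. if j \<in> A then k j else 0"]) (auto simp: S0)
qed

text \<open>The cocycle changes only b-exponents. If all b's became trivial, products would depend
  only on the sum of the a-exponents and \<open>H\<close> would be commutative.\<close>

lemma noncommuting_central_element:
  assumes "\<not> comm_group H"
  shows "\<exists>l. F (\<lambda>_. 0) l \<noteq> \<one>"
proof (rule ccontr)
  assume "\<not> ?thesis"
  then have 1: "F (\<lambda>_. 0) l = \<one>" for l by blast
  have Fg: "F x l = g x" for x l
    using F_central_mult[of x "\<lambda>_. 0" l] by (simp add: 1)
  have "F x l \<otimes> F y l' = g (\<lambda>i. x i + y i)" for x y l l'
    unfolding F_mult by (rule Fg)
  then have comm: "F x l \<otimes> F y l' = F y l' \<otimes> F x l" for x y l l'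
    by (simp add: add.commute)
  have "comm_group H"
  proof (rule group_comm_groupI)
    fix u v assume "u \<in> carrier H" "v \<in> carrier H"
    then obtain x l y l' where "u = F x l" "v = F y l'" using F_surj by blast
    then show "u \<otimes> v = v \<otimes> u" using comm by simp
  qed
  with assms show False by contradiction
qed

lemma central_scale: "F (\<lambda>_. 0) (\<lambda>m. a * l m) = F (\<lambda>_. 0) l [^] (a::int)"
proof -
  have nat: "F (\<lambda>_. 0) (\<lambda>m. int k * l m) = F (\<lambda>_. 0) l [^] int k" for k
  proof (induction k)
    case 0
    then show ?case by (simp add: F_zero)
  next
    case (Suc k)
    have "F (\<lambda>_. 0) (\<lambda>m. int (Suc k) * l m) = F (\<lambda>_. 0) (\<lambda>m. int k * l m) \<otimes> F (\<lambda>_. 0) l"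
      unfolding F_central_mult by (simp add: algebra_simps)
    then show ?case unfolding Suc.IH by (simp only: int_pow_int nat_pow_Suc)
  qed
  show ?thesis
  proof (cases "a \<ge> 0")
    case True
    then show ?thesis using nat[of "nat a"] by simp
  next
    case False
    define k where "k = nat (- a)"
    have a: "a = - int k" using False by (simp add: k_def)
    have "F (\<lambda>_. 0) (\<lambda>m. a * l m) \<otimes> F (\<lambda>_. 0) (\<lambda>m. int k * l m) = \<one>"
      unfolding F_central_mult by (simp add: a F_zero)
    then have "F (\<lambda>_. 0) (\<lambda>m. a * l m) = inv (F (\<lambda>_. 0) l [^] int k)"
      unfolding nat by (simp add: inv_equality)
    then show ?thesis by (simp add: a int_pow_neg)
  qed
qed

text \<open>\<open>W\<close> is the kernel K on the b-exponents. Torsion-freeness serves twice: the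
  image of \<open>l0\<close> has infinite order for the rank count, and no nonzero multiple of
  \<open>l0\<close> lies in \<open>W\<close>, so \<open>\<theta>\<close> exists. The vectors
  \<open>k\<close> lie in U and hence in the radical of the combination of forms with coefficients
  \<open>\<theta>\<close>.\<close>

lemma degenerate_combination:
  assumes rank: "has_polycyclic_rank H N" and "N \<le> n"
    and tf: "torsion_free H" and nc: "\<not> comm_group H"
  shows "\<exists>\<theta> :: nat \<Rightarrow> rat. \<exists>J. (\<exists>m<t. \<theta> m \<noteq> 0) \<and> J \<subseteq> {..<n} \<and> card J = N - 1 \<and>
    (\<forall>i<n. i \<notin> J \<longrightarrow> (\<exists>k :: nat \<Rightarrow> int. k i \<noteq> 0 \<and> (\<forall>j. j \<notin> insert i J \<longrightarrow> k j = 0) \<and>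
       (\<forall>p<n. (\<Sum>m<t. \<theta> m * of_int (\<Sum>j<n. k j * (\<Phi> ! m) $$ (j, p))) = 0)))"
proof -
  obtain l0 where l0: "F (\<lambda>_. 0) l0 \<noteq> \<one>" using noncommuting_central_element[OF nc] by blast
  have inf: "F (\<lambda>_. 0) l0 [^] (k::nat) \<noteq> \<one>" if "k \<ge> 1" for k
    using tf l0 that F_closed unfolding torsion_free_def by blast
  define W where "W = {l. F (\<lambda>_. 0) l = \<one>}"
  have comb: "(\<lambda>m. a * l m + b * l' m) \<in> W" if "l \<in> W" "l' \<in> W" for a b l l'
  proof -
    have "F (\<lambda>_. 0) (\<lambda>m. a * l m + b * l' m) = F (\<lambda>_. 0) l [^] a \<otimes> F (\<lambda>_. 0) l' [^] b"
      unfolding central_scale[symmetric] F_central_mult ..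
    then show ?thesis using that unfolding W_def by simp
  qed
  have l0W: "(\<lambda>m. k * l0 m) \<notin> W" if k: "k \<noteq> 0" for k
  proof
    assume "(\<lambda>m. k * l0 m) \<in> W"
    \<comment> \<open>Multiplication by the sign makes the exponent positive, since
      \<open>torsion_free\<close> speaks of natural powers.\<close>
    note comb[OF this this, of "sgn k" 0]
    moreover have "(\<lambda>m. sgn k * (k * l0 m) + 0 * (k * l0 m)) = (\<lambda>m. \<bar>k\<bar> * l0 m)"
      by (auto simp: sgn_if)
    ultimately have "(\<lambda>m. \<bar>k\<bar> * l0 m) \<in> W" by simp
    then have "F (\<lambda>_. 0) l0 [^] int (nat \<bar>k\<bar>) = \<one>" 
      using central_scale[of "\<bar>k\<bar>" l0] unfolding W_def by simp
    moreover have "nat \<bar>k\<bar> \<ge> 1" using k by (simp add: Suc_le_eq)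
    ultimately show False using inf[of "nat \<bar>k\<bar>"] by (simp only: int_pow_int not_True_eq_False)
  qed
  obtain \<theta> :: "nat \<Rightarrow> rat" where \<theta>: "\<forall>l\<in>W. (\<Sum>m<t. \<theta> m * of_int (l m)) = 0"
      "(\<Sum>m<t. \<theta> m * of_int (l0 m)) \<noteq> 0"
  proof -
    have "y \<in> W" if "x \<in> W" "\<And>m. m < t \<Longrightarrow> x m = y m" for x y
      using that(1) F_cong[of "\<lambda>_. 0" "\<lambda>_. 0" x y] that(2) unfolding W_def by simp
    moreover have "(\<lambda>_. 0) \<in> W" by (simp add: W_def F_zero)
    ultimately show thesis
      using separating_functional[of W t l0, OF comb _ _ l0W] that by blast
  qed
  have nz: "\<exists>m<t. \<theta> m \<noteq> 0"
  proof (rule ccontr)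
    assume "\<not> ?thesis"
    then have "(\<Sum>m<t. \<theta> m * of_int (l0 m)) = 0" by (intro sum.neutral) simp
    with \<theta>(2) show False by contradiction
  qed
  obtain J where J: "J \<subseteq> {..<n}" "card J = N - 1"
    "\<forall>i<n. i \<notin> J \<longrightarrow> (\<exists>k\<in>preimage_mod_center {\<one>}. k i \<noteq> 0 \<and> (\<forall>j. j \<notin> insert i J \<longrightarrow> k j = 0))"
  proof -
    have dep: "\<exists>k\<in>preimage_mod_center {\<one>}. (\<exists>a\<in>A. k a \<noteq> 0) \<and> (\<forall>j. j \<notin> A \<longrightarrow> k j = 0)"
      if "A \<subseteq> {..<n}" "N - 1 < card A" for A
      using polycyclic_rank_dependence[OF rank F_central inf finite_subset[OF that(1) finite_lessThan] that(2)] .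
    have "N - 1 \<le> n" using \<open>N \<le> n\<close> by simp
    from pivot_set[of n "N - 1" "preimage_mod_center {\<one>}", OF dep this] show thesis
      using that by blast
  qed
  have ker: "(\<Sum>m<t. \<theta> m * of_int (\<Sum>j<n. k j * (\<Phi> ! m) $$ (j, p))) = 0"
    if k: "k \<in> preimage_mod_center {\<one>}" and p: "p < n" for k p
  proof -
    \<comment> \<open>Commuting with the p-th generator puts the b-exponents of the commutator into
      \<open>W\<close>; these are the p-th entries of the forms contracted with
      \<open>k\<close>.\<close>
    define y where "y i = (if i = p then 1 else 0 :: int)" for i
    have "g k \<otimes> g y = g y \<otimes> g k" using Z_commute[OF central_if_in_preimage_one[OF k] F_closed] .
    then have "F (\<lambda>i. k i + y i) (twist \<Phi> k y n) = F (\<lambda>i. k i + y i) (twist \<Phi> y k n)"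
      by (simp add: F_mult add.commute)
    also have "F (\<lambda>i. k i + y i) (twist \<Phi> k y n) =
        F (\<lambda>i. k i + y i) (twist \<Phi> y k n) \<otimes> F (\<lambda>_. 0) (\<lambda>m. twist \<Phi> k y n m - twist \<Phi> y k n m)"
      unfolding F_central_mult by simp
    finally have inW: "(\<lambda>m. twist \<Phi> k y n m - twist \<Phi> y k n m) \<in> W"
      unfolding W_def by simp
    have "(\<Sum>m<t. \<theta> m * of_int (twist \<Phi> k y n m - twist \<Phi> y k n m)) = 0"
      by (rule bspec[OF \<theta>(1) inW])
    moreover have "twist \<Phi> k y n m - twist \<Phi> y k n m = (\<Sum>j<n. k j * (\<Phi> ! m) $$ (j, p))" if "m < t" for m
    proof -
      have "(\<Sum>q<n. k j * y q * (\<Phi> ! m) $$ (j, q)) = (\<Sum>q<n. if q = p then k j * (\<Phi> ! m) $$ (j, q) else 0)" for j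
        by (rule sum.cong) (auto simp: y_def)
      then show ?thesis unfolding twist_antisym[OF alt that] using p by simp
    qed
    ultimately show ?thesis by simp
  qed
  show ?thesis
  proof (rule exI[of _ \<theta>], rule exI[of _ J], intro conjI allI impI nz J(1,2))
    fix i assume "i < n" "i \<notin> J"
    then obtain k where k: "k \<in> preimage_mod_center {\<one>}" "k i \<noteq> 0" "\<forall>j. j \<notin> insert i J \<longrightarrow> k j = 0"
      using J(3) by blast
    show "\<exists>k :: nat \<Rightarrow> int. k i \<noteq> 0 \<and> (\<forall>j. j \<notin> insert i J \<longrightarrow> k j = 0) \<and>
       (\<forall>p<n. (\<Sum>m<t. \<theta> m * of_int (\<Sum>j<n. k j * (\<Phi> ! m) $$ (j, p))) = 0)"
      by (rule exI[of _ k], intro conjI allI impI k(2) k(3)[rule_format] ker[OF k(1)])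
  qed
qed

end

section \<open>Charts for tuples with a combination of small rank\<close>

lemma choose_two_add: "(a + b) choose 2 = (a choose 2) + a * b + (b choose 2)"
  by (induction b) (simp_all add: numeral_2_eq_2)

lemma card_increasing_pairs:
  fixes J :: "'a::linorder set"
  assumes "finite J"
  shows "card {(i, j). i \<in> J \<and> j \<in> J \<and> i < j} = card J choose 2"
  using assms
proof (induction J rule: finite_linorder_max_induct)
  case empty
  then show ?case by simp
next
  case (insert b J)
  let ?P = "\<lambda>J. {(i, j). i \<in> J \<and> j \<in> J \<and> i < j}"
  have fin: "finite (?P J)" by (rule finite_subset[of _ "J \<times> J"]) (use insert in auto)
  have "?P (insert b J) = ?P J \<union> J \<times> {b}" using insert.hyps by fastforce
  moreover have "?P J \<inter> J \<times> {b} = {}" using insert.hyps by auto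
  ultimately have "card (?P (insert b J)) = (card J choose 2) + card J"
    using fin insert by (simp add: card_Un_disjoint card_cartesian_product)
  moreover have "b \<notin> J" using insert.hyps by auto
  ultimately show ?case using insert.hyps by (simp add: numeral_2_eq_2)
qed

text \<open>The entries above the diagonal, which are free coordinates on alternating tuples and
  determine all the others.\<close>

definition coords :: "nat \<Rightarrow> nat \<Rightarrow> (nat \<times> nat \<times> nat) set" where
  "coords n t = {..<t} \<times> {(i, j). i \<in> {..<n} \<and> j \<in> {..<n} \<and> i < j}"

lemma finite_coords: "finite (coords n t)"
  unfolding coords_def by (intro finite_cartesian_product finite_subset[of _ "{..<n} \<times> {..<n}"]) auto

lemma card_coords: "card (coords n t) = t * (n choose 2)"
  unfolding coords_def by (simp only: card_cartesian_product card_increasing_pairs finite_lessThan card_lessThan)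

text \<open>The four kinds correspond to the parameter count: t - 1 scalars, the entries of the
  other t - 1 forms, (r choose 2) block entries and r (n - r) pivot coefficients.\<close>

datatype param = Scalar nat | Form "nat \<times> nat \<times> nat" | Block "nat \<times> nat" | Pivot "nat \<times> nat"

definition params :: "nat \<Rightarrow> nat \<Rightarrow> nat \<times> nat set \<Rightarrow> param set" where
  "params n t = (\<lambda>(m0, J). Scalar ` ({..<t} - {m0}) \<union> Form ` (coords n t - {m0} \<times> UNIV) \<union>
     Block ` {(a, b). a \<in> J \<and> b \<in> J \<and> a < b} \<union> Pivot ` (({..<n} - J) \<times> J))"

text \<open>The entries of an n by r matrix P with the identity in the rows of \<open>J\<close>.
  With B the matrix of \<open>block_entry\<close>, the double sum in \<open>chart\<close> is P B
  P^T, the general alternating form of rank at most r with these pivots.\<close>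

definition pivot_coeff :: "nat set \<Rightarrow> (param \<Rightarrow> 'a) \<Rightarrow> nat \<Rightarrow> nat \<Rightarrow> 'a::field" where
  "pivot_coeff J x i a = (if i \<in> J then if i = a then 1 else 0 else x (Pivot (i, a)))"

definition block_entry :: "(param \<Rightarrow> 'a) \<Rightarrow> nat \<Rightarrow> nat \<Rightarrow> 'a::field" where
  "block_entry x a b = (if a < b then x (Block (a, b)) else if b < a then - x (Block (b, a)) else 0)"

text \<open>The chart \<open>(m0, J)\<close> consists of the tuples for which form \<open>m0\<close> plus a combination of the other forms
  is a form \<open>\<psi>\<close> that is determined by its block on \<open>J\<close>: \<open>a\<^sub>i - (\<Sum>a\<in>J. pivot_coeff J x i a * a\<^sub>a)\<close>
  is in the radical of \<open>\<psi>\<close>.\<close>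

definition chart :: "nat \<Rightarrow> nat \<times> nat set \<Rightarrow> nat \<times> nat \<times> nat \<Rightarrow> (param \<Rightarrow> 'a) \<Rightarrow> 'a::field" where
  "chart t = (\<lambda>(m0, J) (m, i, j) x. if m \<noteq> m0 then x (Form (m, i, j)) else
     (\<Sum>a\<in>J. \<Sum>b\<in>J. pivot_coeff J x i a * (pivot_coeff J x j b * block_entry x a b)) -
     (\<Sum>k\<in>{..<t} - {m0}. x (Scalar k) * x (Form (k, i, j))))"

lemma params_bound:
  assumes "m0 < t" "J \<subseteq> {..<n}" "t \<le> (n - card J) choose 2"
  shows "finite (params n t (m0, J))" "card (params n t (m0, J)) < card (coords n t)"
proof -
  let ?r = "card J" and ?P = "{(a, b). a \<in> J \<and> b \<in> J \<and> a < b}"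
  have J: "finite J" using assms(2) finite_subset by blast
  have r: "?r \<le> n" using card_mono[OF _ assms(2)] by simp
  have P: "finite ?P" by (rule finite_subset[of _ "J \<times> J"]) (use J in auto)
  have C: "coords n t - {m0} \<times> UNIV = ({..<t} - {m0}) \<times> {(i, j). i \<in> {..<n} \<and> j \<in> {..<n} \<and> i < j}"
    unfolding coords_def by auto
  have cC: "card (coords n t - {m0} \<times> UNIV) = (t - 1) * (n choose 2)"
    unfolding C using assms(1) by (simp only: card_cartesian_product card_increasing_pairs finite_lessThan card_lessThan) simp
  have cI: "card (({..<n} - J) \<times> J) = (n - ?r) * ?r"
    using assms(2) J by (simp add: card_cartesian_product card_Diff_subset)
  show "finite (params n t (m0, J))"
    unfolding params_def using P J finite_coords by simp
  have "card (params n t (m0, J)) \<le> card (Scalar ` ({..<t} - {m0})) +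
      card (Form ` (coords n t - {m0} \<times> UNIV)) + card (Block ` ?P) + card (Pivot ` (({..<n} - J) \<times> J))"
    unfolding params_def prod.case by (intro order.trans[OF card_Un_le] add_mono order.refl)
  also have "\<dots> = (t - 1) + (t - 1) * (n choose 2) + (?r choose 2) + (n - ?r) * ?r"
    using assms(1) by (simp add: card_image inj_on_def cC cI card_increasing_pairs[OF J] del: card_cartesian_product)
  \<comment> \<open>Strictness comes from the normalised coefficient of form \<open>m0\<close>;
    afterwards \<open>t\<close> is absorbed by the pairs outside \<open>J\<close>.\<close>
  also have "\<dots> < t + (t - 1) * (n choose 2) + (?r choose 2) + (n - ?r) * ?r"
    using assms(1) by simp
  also have "\<dots> \<le> (t - 1) * (n choose 2) + (n choose 2)"
    using choose_two_add[of ?r "n - ?r"] r assms(3) by (simp add: mult.commute)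
  also have "\<dots> = card (coords n t)"
    using assms(1) unfolding card_coords by (cases t) simp_all
  finally show "card (params n t (m0, J)) < card (coords n t)" .
qed

lemma poly_fun_chart:
  assumes "m0 < t" "J \<subseteq> {..<n}" "v \<in> coords n t"
  shows "poly_fun (params n t (m0, J)) 3 (chart t (m0, J) v :: (param \<Rightarrow> 'a::field) \<Rightarrow> 'a)"
proof -
  let ?W = "params n t (m0, J)"
  obtain m i j where v: "v = (m, i, j)" "m < t" "i < j" "i < n" "j < n"
    using assms(3) unfolding coords_def by auto
  have J: "finite J" using assms(2) finite_subset by blast
  have "finite {(a, b). a \<in> J \<and> b \<in> J \<and> a < b}"
    by (rule finite_subset[of _ "J \<times> J"]) (use J in auto)
  then have fin: "finite ?W"
    unfolding params_def using J finite_coords by simp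
  note var = poly_fun_var[OF _ fin, where 'b = 'a]
  have piv: "poly_fun ?W 1 (\<lambda>x :: param \<Rightarrow> 'a. pivot_coeff J x p a)" if "p < n" "a \<in> J" for p a
  proof (cases "p \<in> J")
    case False
    then have "Pivot (p, a) \<in> ?W" using that unfolding params_def by blast
    from False var[OF this] show ?thesis by (simp add: pivot_coeff_def)
  qed (simp add: pivot_coeff_def poly_fun_const)
  have blk: "poly_fun ?W 1 (\<lambda>x :: param \<Rightarrow> 'a. block_entry x a b)" if "a \<in> J" "b \<in> J" for a b
  proof (cases a b rule: linorder_cases)
    case less
    then have "Block (a, b) \<in> ?W" using that unfolding params_def by blast
    from less var[OF this] show ?thesis by (simp add: block_entry_def)
  next
    case greater
    then have "Block (b, a) \<in> ?W" using that unfolding params_def by blast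
    from greater poly_fun_uminus[OF var[OF this]] show ?thesis by (simp add: block_entry_def)
  qed (simp add: block_entry_def poly_fun_const)
  \<comment> \<open>Degree 3 arises from two pivot coefficients and one block entry; the other terms
    are at most quadratic.\<close>
  have "poly_fun ?W 3 (\<lambda>x :: param \<Rightarrow> 'a. pivot_coeff J x i a * (pivot_coeff J x j b * block_entry x a b))"
    if "a \<in> J" "b \<in> J" for a b
    using poly_fun_mult[OF piv poly_fun_mult[OF piv blk]] that v by (simp add: numeral_3_eq_3)
  then have 1: "poly_fun ?W 3 (\<lambda>x :: param \<Rightarrow> 'a. \<Sum>a\<in>J. \<Sum>b\<in>J. pivot_coeff J x i a * (pivot_coeff J x j b * block_entry x a b))"
    by (intro poly_fun_sum)
  have "poly_fun ?W (1 + 1) (\<lambda>x :: param \<Rightarrow> 'a. x (Scalar k) * x (Form (k, i, j)))" if k: "k \<in> {..<t} - {m0}" for k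
  proof -
    have "Scalar k \<in> ?W" using k unfolding params_def by blast
    moreover have "(k, i, j) \<in> coords n t - {m0} \<times> UNIV" using k v by (simp add: coords_def)
    then have "Form (k, i, j) \<in> ?W" unfolding params_def by blast
    ultimately show ?thesis by (intro poly_fun_mult var) simp_all
  qed
  then have "poly_fun ?W (1 + 1) (\<lambda>x :: param \<Rightarrow> 'a. \<Sum>k\<in>{..<t} - {m0}. x (Scalar k) * x (Form (k, i, j)))"
    by (rule poly_fun_sum)
  then have 2: "poly_fun ?W 3 (\<lambda>x :: param \<Rightarrow> 'a. \<Sum>k\<in>{..<t} - {m0}. x (Scalar k) * x (Form (k, i, j)))"
    by (rule poly_fun_mono) simp
  show ?thesis
  proof (cases "m = m0")
    case True
    then show ?thesis
      using poly_fun_add[OF 1 poly_fun_uminus[OF 2]] unfolding chart_def v by simp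
  next
    case False
    then have "(m, i, j) \<in> coords n t - {m0} \<times> UNIV" using v by (simp add: coords_def)
    then have "Form (m, i, j) \<in> ?W" unfolding params_def by blast
    then have "poly_fun ?W 3 (\<lambda>x :: param \<Rightarrow> 'a. x (Form (m, i, j)))" by (rule var) simp
    with False show ?thesis unfolding chart_def v by simp
  qed
qed

text \<open>After division by \<open>\<theta> m0\<close> the combination \<open>\<psi>\<close>
  contains form \<open>m0\<close> with coefficient 1, so that form is \<open>\<psi>\<close> minus
  multiples of the others. The radical vectors reduce both arguments of \<open>\<psi>\<close> to
  \<open>J\<close>.\<close>

lemma degenerate_tuple_in_chart:
  fixes \<Phi> :: "int mat list" and \<theta> :: "nat \<Rightarrow> rat"
  assumes alt: "\<Phi> \<in> alt_tuples n t" and m0: "m0 < t" "\<theta> m0 \<noteq> 0" and J: "J \<subseteq> {..<n}"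
    and deg: "\<And>i. i < n \<Longrightarrow> i \<notin> J \<Longrightarrow> \<exists>k :: nat \<Rightarrow> int. k i \<noteq> 0 \<and> (\<forall>j. j \<notin> insert i J \<longrightarrow> k j = 0) \<and>
       (\<forall>p<n. (\<Sum>m<t. \<theta> m * of_int (\<Sum>j<n. k j * (\<Phi> ! m) $$ (j, p))) = 0)"
  shows "\<exists>x. \<forall>v\<in>coords n t. tuple_coord n t (rat_tuple \<Phi>) v = chart t (m0, J) v x"
proof -
  define \<phi> where "\<phi> m i j = rat_of_int ((\<Phi> ! m) $$ (i, j))" for m i j
  define c where "c m = \<theta> m / \<theta> m0" for m
  define \<psi> where "\<psi> i j = (\<Sum>m<t. c m * \<phi> m i j)" for i j
  have forms: "\<Phi> ! m \<in> alt_forms n" if "m < t" for m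
    using alt that by (force simp: alt_tuples_def)
  have alt\<phi>: "\<phi> m i i = 0" "\<phi> m i j = - \<phi> m j i" if "m < t" "i < n" "j < n" for m i j
  proof -
    have "(\<Phi> ! m) $$ (i, i) = 0" "(\<Phi> ! m) $$ (i, j) = - (\<Phi> ! m) $$ (j, i)"
      using forms[OF that(1)] that(2,3) unfolding alt_forms_def by blast+
    then show "\<phi> m i i = 0" "\<phi> m i j = - \<phi> m j i" by (simp_all only: \<phi>_def of_int_minus of_int_0)
  qed
  have alt\<psi>: "\<psi> i i = 0" if "i < n" for i
    unfolding \<psi>_def using alt\<phi>(1)[OF _ that that] by (intro sum.neutral) simp
  have anti: "\<psi> i j = - \<psi> j i" if "i < n" "j < n" for i j
  proof -
    have "\<psi> i j = (\<Sum>m<t. - (c m * \<phi> m j i))"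
      unfolding \<psi>_def by (rule sum.cong) (use alt\<phi>(2)[OF _ that] in simp_all)
    then show ?thesis by (simp add: \<psi>_def sum_negf)
  qed
  have "\<forall>i. \<exists>k :: nat \<Rightarrow> int. i < n \<and> i \<notin> J \<longrightarrow> k i \<noteq> 0 \<and> (\<forall>j. j \<notin> insert i J \<longrightarrow> k j = 0) \<and>
       (\<forall>p<n. (\<Sum>m<t. \<theta> m * of_int (\<Sum>j<n. k j * (\<Phi> ! m) $$ (j, p))) = 0)"
    using deg by blast
  from choice[OF this] obtain k :: "nat \<Rightarrow> nat \<Rightarrow> int" where
    k: "\<forall>i. i < n \<and> i \<notin> J \<longrightarrow> k i i \<noteq> 0 \<and> (\<forall>j. j \<notin> insert i J \<longrightarrow> k i j = 0) \<and>
       (\<forall>p<n. (\<Sum>m<t. \<theta> m * of_int (\<Sum>j<n. k i j * (\<Phi> ! m) $$ (j, p))) = 0)" ..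
  \<comment> \<open>The pivot entries solve the radical relation, with k_i a_i plus the k_a a_a for
    a in \<open>J\<close>, for a_i.\<close>
  define x where "x w = (case w of Scalar m \<Rightarrow> c m | Form (m, i, j) \<Rightarrow> \<phi> m i j | Block (a, b) \<Rightarrow> \<psi> a b
      | Pivot (i, a) \<Rightarrow> - of_int (k i a) / of_int (k i i))" for w
  have finJ: "finite J" using J finite_subset by blast
  have expand: "\<psi> i p = (\<Sum>a\<in>J. pivot_coeff J x i a * \<psi> a p)" if "i < n" "p < n" for i p
  proof (cases "i \<in> J")
    case True
    have "(\<Sum>a\<in>J. pivot_coeff J x i a * \<psi> a p) = (\<Sum>a\<in>J. if i = a then \<psi> a p else 0)"
      by (rule sum.cong) (use True in \<open>auto simp: pivot_coeff_def\<close>)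
    then show ?thesis using True finJ by simp
  next
    case False
    have ki: "k i i \<noteq> 0" "\<And>j. j \<notin> insert i J \<Longrightarrow> k i j = 0"
      "(\<Sum>m<t. \<theta> m * of_int (\<Sum>j<n. k i j * (\<Phi> ! m) $$ (j, p))) = 0"
      using k False that by blast+
    have "0 = (\<Sum>m<t. \<Sum>j<n. \<theta> m * (of_int (k i j) * \<phi> m j p)) / \<theta> m0"
      using ki(3) by (simp add: \<phi>_def sum_distrib_left)
    also have "\<dots> = (\<Sum>m<t. \<Sum>j<n. of_int (k i j) * (c m * \<phi> m j p))"
      unfolding c_def sum_divide_distrib by (intro sum.cong refl) simp
    also have "\<dots> = (\<Sum>j<n. of_int (k i j) * \<psi> j p)"
      unfolding \<psi>_def sum_distrib_left by (rule sum.swap)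
    also have "\<dots> = (\<Sum>j\<in>insert i J. of_int (k i j) * \<psi> j p)"
      using that J ki(2) by (intro sum.mono_neutral_right) auto
    also have "\<dots> = of_int (k i i) * \<psi> i p + (\<Sum>j\<in>J. of_int (k i j) * \<psi> j p)"
      using False finJ by simp
    finally have "\<psi> i p * of_int (k i i) = - (\<Sum>j\<in>J. of_int (k i j) * \<psi> j p)"
      by (simp only: mult.commute eq_neg_iff_add_eq_0)
    then have "\<psi> i p = - (\<Sum>j\<in>J. of_int (k i j) * \<psi> j p) / of_int (k i i)"
      using ki(1) by (subst eq_divide_eq) simp
    also have "\<dots> = (\<Sum>a\<in>J. pivot_coeff J x i a * \<psi> a p)"
      using False by (simp add: pivot_coeff_def x_def sum_negf sum_divide_distrib)
    finally show ?thesis .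
  qed
  have block: "block_entry x a b = \<psi> a b" if "a < n" "b < n" for a b
    using anti[OF that] alt\<psi>[OF that(1)]
    by (cases a b rule: linorder_cases) (auto simp: block_entry_def x_def)
  have \<psi>_block: "\<psi> i j = (\<Sum>a\<in>J. \<Sum>b\<in>J. pivot_coeff J x i a * (pivot_coeff J x j b * block_entry x a b))"
    if "i < n" "j < n" for i j
  proof -
    \<comment> \<open>Skew symmetry carries the expansion over from the first argument to the
      second.\<close>
    have *: "\<psi> a j = (\<Sum>b\<in>J. pivot_coeff J x j b * block_entry x a b)" if a: "a \<in> J" for a
    proof -
      have an: "a < n" using a J by auto
      have "\<psi> a j = - \<psi> j a" using anti[OF an \<open>j < n\<close>] .
      also have "\<dots> = (\<Sum>b\<in>J. pivot_coeff J x j b * - \<psi> b a)"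
        unfolding expand[OF \<open>j < n\<close> an] by (simp add: sum_negf)
      also have "\<dots> = (\<Sum>b\<in>J. pivot_coeff J x j b * block_entry x a b)"
      proof (rule sum.cong[OF refl])
        fix b assume "b \<in> J"
        then have "b < n" using J by auto
        then show "pivot_coeff J x j b * - \<psi> b a = pivot_coeff J x j b * block_entry x a b"
          using anti[OF an, of b] block[OF an, of b] by simp
      qed
      finally show ?thesis .
    qed
    have "\<psi> i j = (\<Sum>a\<in>J. pivot_coeff J x i a * \<psi> a j)" by (rule expand[OF that])
    also have "\<dots> = (\<Sum>a\<in>J. \<Sum>b\<in>J. pivot_coeff J x i a * (pivot_coeff J x j b * block_entry x a b))"
      by (rule sum.cong) (simp_all add: * sum_distrib_left)
    finally show ?thesis .
  qed
  have "tuple_coord n t (rat_tuple \<Phi>) v = chart t (m0, J) v x" if v: "v \<in> coords n t" for v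
  proof -
    obtain m i j where mij: "v = (m, i, j)" "m < t" "i < n" "j < n"
      using v unfolding coords_def by auto
    have len: "length \<Phi> = t" using alt by (simp add: alt_tuples_def)
    have dims: "\<Phi> ! m \<in> carrier_mat n n" using forms[OF mij(2)] by (simp add: alt_forms_def)
    have lhs: "tuple_coord n t (rat_tuple \<Phi>) v = \<phi> m i j"
      using mij dims len by (simp add: tuple_coord_def rat_tuple_def \<phi>_def)
    show ?thesis
    proof (cases "m = m0")
      case False
      then show ?thesis unfolding lhs by (simp add: mij chart_def x_def)
    next
      case True
      have "\<psi> i j = c m0 * \<phi> m0 i j + (\<Sum>m\<in>{..<t} - {m0}. c m * \<phi> m i j)"
        unfolding \<psi>_def using m0(1) by (simp add: sum.remove)
      moreover have "c m0 = 1" using m0(2) by (simp add: c_def)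
      moreover have "(\<Sum>m\<in>{..<t} - {m0}. c m * \<phi> m i j) = (\<Sum>k\<in>{..<t} - {m0}. x (Scalar k) * x (Form (k, i, j)))"
        by (simp add: x_def)
      ultimately have "\<phi> m0 i j = \<psi> i j - (\<Sum>k\<in>{..<t} - {m0}. x (Scalar k) * x (Form (k, i, j)))" by simp
      then show ?thesis unfolding lhs using True \<psi>_block[OF mij(3,4)] by (simp add: mij chart_def)
    qed
  qed
  then show ?thesis by blast
qed

section \<open>From the charts to a proper Zariski-closed set\<close>

lemma monomial_cong: "(\<And>v. v \<in> V \<Longrightarrow> x v = y v) \<Longrightarrow> monomial V \<mu> x = monomial V \<mu> y"
  unfolding monomial_def by (rule prod.cong) simp_all

lemma rat_tuple_alt_tuples:
  assumes "\<Phi> \<in> alt_tuples n t"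
  shows "rat_tuple \<Phi> \<in> alt_tuples n t"
proof -
  have "map_mat rat_of_int B \<in> alt_forms n" if "B \<in> alt_forms n" for B :: "int mat"
  proof -
    have B: "B \<in> carrier_mat n n" using that by (simp add: alt_forms_def)
    have e: "map_mat rat_of_int B $$ (i, i) = 0" "map_mat rat_of_int B $$ (i, j) = - map_mat rat_of_int B $$ (j, i)"
      if ij: "i < n" "j < n" for i j
    proof -
      have "B $$ (i, i) = 0" "B $$ (i, j) = - B $$ (j, i)"
        using \<open>B \<in> alt_forms n\<close> ij unfolding alt_forms_def by blast+
      then show "map_mat rat_of_int B $$ (i, i) = 0"
        "map_mat rat_of_int B $$ (i, j) = - map_mat rat_of_int B $$ (j, i)"
        using B ij by simp_all
    qed
    show ?thesis unfolding alt_forms_def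
      by (intro CollectI conjI allI impI e(2)) (use B e(1) in simp_all)
  qed
  with assms show ?thesis unfolding alt_tuples_def rat_tuple_def by auto
qed

text \<open>With u = n - N the real bound is u (u + 1) / 2 + 1, that is, (u + 1 choose 2) + 1. The
  final 1 turns the strict inequality into a weak one between integers.\<close>

lemma rank_bound_nat:
  assumes "N > 0" "N < n"
    and "real t < real n ^ 2 / 2 - real n * (real N - 1 / 2) + real N * (real N - 1) / 2 + 1"
  shows "t \<le> (n - (N - 1)) choose 2"
proof -
  define u where "u = n - N"
  have n: "n = N + u" and s: "n - (N - 1) = Suc u" using assms(1,2) by (simp_all add: u_def)
  have "2 * real t < real u * (real u + 1) + 2"
    using assms(3) unfolding n by (simp add: power2_eq_square field_simps)
  then have "real (2 * t) < real (u * (u + 1) + 2)" by (simp add: algebra_simps)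
  then have "2 * t < u * (u + 1) + 2" by (simp only: of_nat_less_iff)
  moreover have "2 * (Suc u choose 2) = u * (u + 1)"
    unfolding choose_two by simp
  ultimately have "2 * t < 2 * (Suc u choose 2) + 2" by simp
  then show ?thesis unfolding s by simp
qed

theorem mainTheorem9:
  fixes n t N :: nat
  assumes "n > 0" and "t > 0" and "N > 0" and "N < n"
    and "real t < real n ^ 2 / 2 - real n * (real N - 1 / 2) + real N * (real N - 1) / 2 + 1"
  shows "generic_N2 n t (\<lambda>G. \<not> (\<exists>(H :: 'b monoid) f.
           group H \<and> torsion_free H \<and> \<not> comm_group H \<and> has_polycyclic_rank H N \<and> f \<in> epi G H))"
proof -
  have bound: "t \<le> (n - (N - 1)) choose 2" using rank_bound_nat assms(3-5) .
  let ?V = "coords n t"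
  define C where "C = {..<t} \<times> {J. J \<subseteq> {..<n} \<and> card J = N - 1}"
  have finC: "finite C" unfolding C_def by simp
  have C: "\<exists>m0 J. c = (m0, J) \<and> m0 < t \<and> J \<subseteq> {..<n} \<and> t \<le> (n - card J) choose 2" if "c \<in> C" for c
    using that bound unfolding C_def by auto
  have "\<exists>D a. (\<exists>\<mu>\<in>exps ?V D. a \<mu> \<noteq> (0::rat)) \<and>
      (\<forall>c\<in>C. \<forall>x. (\<Sum>\<mu>\<in>exps ?V D. a \<mu> * monomial ?V \<mu> (\<lambda>v. chart t c v x)) = 0)"
  proof (rule algebraic_dependence[OF finC finite_coords])
    fix c assume "c \<in> C"
    then obtain m0 J where c: "c = (m0, J)" "m0 < t" "J \<subseteq> {..<n}" "t \<le> (n - card J) choose 2"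
      using C by blast
    show "finite (params n t c)" "card (params n t c) < card ?V"
      unfolding c(1) by (rule params_bound[OF c(2-4)])+
    show "poly_fun (params n t c) 3 (chart t c v :: (param \<Rightarrow> rat) \<Rightarrow> rat)" if "v \<in> ?V" for v
      unfolding c(1) by (rule poly_fun_chart[OF c(2,3) that])
  qed
  then obtain D and a :: "(nat \<times> nat \<times> nat \<Rightarrow> nat) \<Rightarrow> rat" where
    a: "\<exists>\<mu>\<in>exps ?V D. a \<mu> \<noteq> 0"
      "\<And>c x. c \<in> C \<Longrightarrow> (\<Sum>\<mu>\<in>exps ?V D. a \<mu> * monomial ?V \<mu> (\<lambda>v. chart t c v x)) = 0"
    by blast
  obtain p where p: "\<And>x. poly_val p x = (\<Sum>\<mu>\<in>exps ?V D. a \<mu> * monomial ?V \<mu> x)"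
    using poly_val_of_coeffs[OF finite_coords, where D = D and a = a] by blast
  \<comment> \<open>Only entries above the diagonal enter \<open>p\<close>, so agreement with a
    chart on these suffices.\<close>
  have p_cong: "poly_val p x = poly_val p y" if "\<And>v. v \<in> ?V \<Longrightarrow> x v = y v" for x y
    unfolding p using monomial_cong[of ?V x y] that by simp
  obtain y where y: "poly_val p y \<noteq> 0"
    using nonzero_poly_has_nonroot[OF finite_coords a(1)] unfolding p by blast
  define X where "X = {\<Psi> \<in> alt_tuples n t. poly_val p (tuple_coord n t \<Psi>) = 0}"
  have closed: "zariski_closed n t X"
    unfolding zariski_closed_def X_def by (rule exI[of _ "{p}"]) simp
  \<comment> \<open>The nonroot \<open>y\<close> is an arbitrary assignment of values; its part
    above the diagonal is completed to an alternating tuple, which witnesses that \<open>X\<close>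
    is proper.\<close>
  define \<Psi> where "\<Psi> = map (\<lambda>m. mat n n (\<lambda>(i, j). if i < j then y (m, i, j)
      else if j < i then - y (m, j, i) else 0)) [0..<t]"
  have "\<Psi> \<in> alt_tuples n t"
    unfolding \<Psi>_def alt_tuples_def alt_forms_def by auto
  moreover have "poly_val p (tuple_coord n t \<Psi>) = poly_val p y"
    by (rule p_cong) (auto simp: coords_def tuple_coord_def \<Psi>_def)
  ultimately have "\<Psi> \<in> alt_tuples n t - X" using y by (simp add: X_def)
  then have proper: "X \<subset> alt_tuples n t" unfolding X_def by blast
  have "rat_tuple \<Phi> \<in> X" if \<Phi>: "\<Phi> \<in> indep_tuples n t" and H: "group H" "torsion_free H" "\<not> comm_group H"
    "has_polycyclic_rank H N" "f \<in> epi (form_group n t \<Phi>) H" for \<Phi> and H :: "'b monoid" and f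
  proof -
    have alt: "\<Phi> \<in> alt_tuples n t" using \<Phi> by (simp add: indep_tuples_def)
    interpret form_group_quotient H n t \<Phi> f
      using H(1,5) alt by (intro form_group_quotient.intro form_group_quotient_axioms.intro)
    obtain \<theta> :: "nat \<Rightarrow> rat" and J m0 where
      m0: "m0 < t" "\<theta> m0 \<noteq> 0" and deg: "J \<subseteq> {..<n}" "card J = N - 1"
      "\<forall>i<n. i \<notin> J \<longrightarrow> (\<exists>k :: nat \<Rightarrow> int. k i \<noteq> 0 \<and> (\<forall>j. j \<notin> insert i J \<longrightarrow> k j = 0) \<and>
         (\<forall>p<n. (\<Sum>m<t. \<theta> m * of_int (\<Sum>j<n. k j * (\<Phi> ! m) $$ (j, p))) = 0))"
      using degenerate_combination[OF H(4) less_imp_le[OF assms(4)] H(2,3)] by (elim exE conjE) (rule that)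
    obtain x where x: "\<forall>v\<in>?V. tuple_coord n t (rat_tuple \<Phi>) v = chart t (m0, J) v x"
      using degenerate_tuple_in_chart[OF alt m0 deg(1) deg(3)[rule_format]] by blast
    have "poly_val p (tuple_coord n t (rat_tuple \<Phi>)) = poly_val p (\<lambda>v. chart t (m0, J) v x)"
      using x by (intro p_cong) simp
    also have "\<dots> = 0" unfolding p using m0(1) deg(1,2) by (intro a(2)) (simp add: C_def)
    finally have "poly_val p (tuple_coord n t (rat_tuple \<Phi>)) = 0" .
    moreover have "rat_tuple \<Phi> \<in> alt_tuples n t"
      using alt by (rule rat_tuple_alt_tuples)
    ultimately show ?thesis by (simp add: X_def)
  qed
  then have "rat_tuple ` {\<Phi> \<in> indep_tuples n t. \<not> \<not> (\<exists>(H :: 'b monoid) f.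
      group H \<and> torsion_free H \<and> \<not> comm_group H \<and> has_polycyclic_rank H N \<and> f \<in> epi (form_group n t \<Phi>) H)} \<subseteq> X"
    by blast
  with closed proper show ?thesis unfolding generic_N2_def by blast
qed

end
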